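(* Let $d\geq 1$ be an integer, $s>0$ and $1\leq p\leq 2$ with $s/d\geq 1-1/p$. Then there is a constant $c>0$, depending only on $s,d$ and $p$ (not on $n$), such that for every integer $n\geq 2$ the Fourier sampling numbers of the Besov ball $K^s_1$ in $L_p$ satisfy $$ s^F_n(K^s_1)_{L_p} \geq c\,n^{-s/d}(\log n)^{\gamma_p}, $$ where $$ \gamma_p := \max\left\{0,\ \frac{\log\left(\frac{\pi}{2^{1+1/p}}\right)}{\log 2}\right\}. $$
   Context: $\mathbb{T}^d := (\mathbb{R}/2\pi\mathbb{Z})^d$ is the $d$-dimensional torus. All $L_p$ norms are taken over $\mathbb{T}^d$ with respect to Lebesgue measure normalized to have total mass $1$, i.e. $\int_{\mathbb{T}^d} := \frac{1}{(2\pi)^d}\int_{[0,2\pi]^d}$. Functions are complex valued. Logarithms are taken to base $2$. Besov norm: for $s>0$, fix an integer $k>s$ (different choices of $k>s$ give equivalent norms). For $h\in\mathbb{R}^d$ let $\Delta_h f(x) = f(x+h)-f(x)$, let $\Delta_h^k$ be its $k$-th iterate, and let $\omega_k(f,t)_1 := \sup_{|h|\leq t}\|\Delta_h^k f\|_{L_1}$. Set $|f|_{B^s_\infty(L_1)} := \sup_{t>0}t^{-s}\omega_k(f,t)_1$ and $\|f\|_{B^s_\infty(L_1)} := \|f\|_{L_1}+|f|_{B^s_\infty(L_1)}$. The Besov ball is $K^s_1 := \{f:\mathbb{T}^d\to\mathbb{C} : \|f\|_{B^s_\infty(L_1)}\leq 1\}$. Fourier coefficients: $\hat f(\xi) :=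 \int_{\mathbb{T}^d} f(x)e^{-i\xi\cdot x}\,dx$ for $\xi\in\mathbb{Z}^d$ (normalized measure). Fourier sampling numbers: for a class $K$ of functions and $n\geq 1$, $$s^F_n(K)_{L_p} := \inf_{\xi_1,\dots,\xi_n\in\mathbb{Z}^d}\ \sup\{\|f\|_{L_p} : f\in K \text{ and } \hat f(\xi_i)=0 \text{ for } i=1,\dots,n\},$$ a value in $[0,\infty]$, where $\|f\|_{L_p}=+\infty$ if $f\notin L_p$. *)

theory Defs
  imports "HOL-Analysis.Analysis"
begin

text \<open>Functions on the torus (R / 2 pi Z)^d are functions on \<^typ>\<open>real ^ 'd\<close>, with d = CARD('d),
  that are 2 pi periodic in every coordinate.\<close>

definition torus_function :: "(real ^ 'd::finite \<Rightarrow> complex) \<Rightarrow> bool" where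
  "torus_function f \<longleftrightarrow>
     f \<in> borel_measurable lebesgue \<and> (\<forall>x j. f (x + (2 * pi) *\<^sub>R axis j 1) = f x)"

definition torus_measure :: "(real ^ 'd::finite) measure" where
  "torus_measure = uniform_measure lebesgue (cbox 0 (\<chi> j. 2 * pi))"

text \<open>The case distinction only extends the power 1/p to infinity.\<close>

definition torus_Lp_norm :: "real \<Rightarrow> (real ^ 'd::finite \<Rightarrow> complex) \<Rightarrow> ennreal" where
  "torus_Lp_norm p f =
     (let I = (\<integral>\<^sup>+ x. ennreal (cmod (f x) powr p) \<partial>torus_measure)
      in if I = \<infinity> then \<infinity> else ennreal (enn2real I powr (1 / p)))"

definition fdiff :: "real ^ 'd::finite \<Rightarrow> (real ^ 'd \<Rightarrow> complex) \<Rightarrow> real ^ 'd \<Rightarrow> complex" where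
  "fdiff h f = (\<lambda>x. f (x + h) - f x)"

definition modulus_of_smoothness_L1 ::
    "nat \<Rightarrow> (real ^ 'd::finite \<Rightarrow> complex) \<Rightarrow> real \<Rightarrow> ennreal" where
  "modulus_of_smoothness_L1 k f t = (SUP h \<in> {h. norm h \<le> t}. torus_Lp_norm 1 ((fdiff h ^^ k) f))"

definition besov_seminorm :: "nat \<Rightarrow> real \<Rightarrow> (real ^ 'd::finite \<Rightarrow> complex) \<Rightarrow> ennreal" where
  "besov_seminorm k s f = (SUP t \<in> {0<..}. ennreal (t powr (- s)) * modulus_of_smoothness_L1 k f t)"

definition besov_norm :: "nat \<Rightarrow> real \<Rightarrow> (real ^ 'd::finite \<Rightarrow> complex) \<Rightarrow> ennreal" where
  "besov_norm k s f = torus_Lp_norm 1 f + besov_seminorm k s f"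

text \<open>The order k of the difference stays an explicit parameter; it is meant to satisfy k > s.\<close>

definition besov_ball :: "nat \<Rightarrow> real \<Rightarrow> (real ^ 'd::finite \<Rightarrow> complex) set" where
  "besov_ball k s = {f. torus_function f \<and> besov_norm k s f \<le> 1}"

definition fourier_coeff :: "(real ^ 'd::finite \<Rightarrow> complex) \<Rightarrow> int ^ 'd \<Rightarrow> complex" where
  "fourier_coeff f \<xi> =
     (\<integral>x. f x * exp (- \<i> * complex_of_real (\<Sum>j\<in>UNIV. real_of_int (\<xi> $ j) * x $ j)) \<partial>torus_measure)"

definition fourier_sampling_number ::
    "(real ^ 'd::finite \<Rightarrow> complex) set \<Rightarrow> real \<Rightarrow> nat \<Rightarrow> ennreal" where
  "fourier_sampling_number K p n =
     (INF \<xi> \<in> (UNIV :: (nat \<Rightarrow> int ^ 'd) set).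
        SUP f \<in> {f \<in> K. \<forall>i\<in>{1..n}. fourier_coeff f (\<xi> i) = 0}. torus_Lp_norm p f)"

definition gamma_exponent :: "real \<Rightarrow> real" where
  "gamma_exponent p = max 0 (log 2 (pi / 2 powr (1 + 1 / p)) / log 2 2)"

end

theory Submission
  imports Defs
begin

text \<open>
  It suffices to find, for any \<open>n\<close> forbidden frequencies, one function in the Besov ball whose
  Fourier coefficients vanish there and whose \<open>L\<^sub>p\<close> norm is large. A single exponential of
  frequency about \<open>n\<close> to the power \<open>1 / d\<close> already gives the rate \<open>n\<close> to the power \<open>- s / d\<close>. The
  logarithm comes from replacing that exponential by a Riesz product
  \<open>exp (i \<xi> \<bullet> x) * (\<Prod>j<m. 1 + exp (i a\<^sub>j x\<^sub>1))\<close>. Its modulus is \<open>\<Prod>j<m. 2 * \<bar>cos (a\<^sub>j x\<^sub>1 / 2)\<bar>\<close>.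
  If the \<open>a\<^sub>j\<close> grow fast, the factors behave like independent random variables. The mean of
  \<open>\<bar>cos\<bar>\<close> is \<open>2 / \<pi>\<close>, so the \<open>L\<^sub>1\<close> norm is at most a constant times \<open>(4 / \<pi>) ^ m\<close>. For
  \<open>p \<le> 2\<close> we have \<open>\<bar>cos\<bar> powr p \<ge> cos\<^sup>2\<close>, whose mean is \<open>1 / 2\<close>, so the \<open>L\<^sub>p\<close> norm is at least
  a constant times \<open>2 powr (m * (1 - 1 / p))\<close>. The quotient of the two norms thus grows like
  \<open>(\<pi> / 2 powr (1 + 1 / p)) ^ m\<close>, which is a power of \<open>log n\<close> with the claimed exponent as soon
  as \<open>2 ^ m\<close> is comparable to \<open>log n\<close>.

  The frequencies of the Riesz product form the cube of all \<open>\<xi> + (\<Sum>j\<in>T. a\<^sub>j)\<close> times a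
  unit vector, with \<open>T \<subseteq> {..<m}\<close>. The box of side \<open>N\<close>, with \<open>N ^ d \<ge> 2 * n\<close>, contains a line on
  which at least half of the points are allowed (\<open>line_with_few_points\<close>). By a quantitative version
  of the cube lemma of Hilbert (\<open>lacunary_cube\<close>), a subset of \<open>{0..<N}\<close> of density \<open>1 / 2\<close> contains
  a cube with \<open>2 ^ m\<close> comparable to \<open>log N\<close>: each step squares the density, up to a constant, so
  that about \<open>log (log N)\<close> steps are possible. The differences can be taken in prescribed windows,
  which makes them lacunary.

  The norms are computed by letting one factor at a time oscillate against the slower product of its
  predecessors (\<open>integral_mult_slow_fast\<close>). The Besov norm requires a Bernstein inequality in
  \<open>L\<^sub>1\<close> with a constant that does not depend on \<open>m\<close>. It follows from the product rule for
  differences (\<open>riesz_product_difference\<close>): a difference of a Riesz product is a combination of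
  Riesz products with fewer factors, and dropping factors only improves the bound on the \<open>L\<^sub>1\<close> norm.
\<close>

section \<open>Lacunary cubes in dense sets of frequencies\<close>

text \<open>
  Each of the \<open>K\<close> translates of \<open>A\<close> by multiples of \<open>q\<close> lies in \<open>{0..<2 * N}\<close>, so by the
  Cauchy-Schwarz inequality two different translates overlap as much as in the random case, up to a
  constant. Using multiples of \<open>q\<close> only is what keeps the difference between \<open>q\<close> and \<open>K * q\<close>.
\<close>

lemma dense_set_has_popular_difference:
  fixes A :: "int set" and N q :: int and K :: nat
  assumes A: "A \<subseteq> {0..<N}" and N: "0 < N" and q: "0 < q"
    and Kq: "int K * q \<le> N" and dense: "4 * N \<le> int K * int (card A)"
  shows "\<exists>a. q \<le> a \<and> a \<le> int K * q \<and>
             (int (card A))\<^sup>2 \<le> 4 * N * int (card {x \<in> A. x + a \<in> A})"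
proof (rule ccontr)
  assume "\<not> ?thesis"
  then have few: "4 * N * int (card {x \<in> A. x + a \<in> A}) < (int (card A))\<^sup>2"
    if "q \<le> a" "a \<le> int K * q" for a
    using that by force
  define X where "X = {0..<2 * N}"
  define I where "I = (\<lambda>(i::nat) x. of_bool (x - int i * q \<in> A) :: real)"
  define n where "n = real (card A)"
  have shift_bound: "y + int i * q \<in> X" if "y \<in> A" "i < K" for y i
  proof -
    have "int i * q \<le> int K * q"
      using that q by (intro mult_right_mono) auto
    moreover have "0 \<le> int i * q"
      using q by simp
    ultimately show ?thesis
      using that A Kq by (force simp: X_def)
  qed
  have sum_I: "(\<Sum>x\<in>X. I i x) = n" if "i < K" for i
  proof -
    have "(\<Sum>x\<in>X. I i x) = real (card {x \<in> X. x - int i * q \<in> A})"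
      by (simp add: I_def X_def Int_def)
    also have "{x \<in> X. x - int i * q \<in> A} = (\<lambda>y. y + int i * q) ` A"
      using shift_bound that by (force simp: image_iff)
    also have "card \<dots> = card A"
      by (intro card_image) (auto simp: inj_on_def)
    finally show ?thesis by (simp add: n_def)
  qed
  have overlap_less: "(\<Sum>x\<in>X. I i x * I i' x) \<le> n\<^sup>2 / (4 * N)" if "i < i'" "i' < K" for i i'
  proof -
    define a where "a = (int i' - int i) * q"
    have "(\<Sum>x\<in>X. I i x * I i' x) = real (card {x \<in> X. x - int i * q \<in> A \<and> x - int i' * q \<in> A})"
      by (simp add: I_def X_def Int_def flip: of_bool_conj)
    also have "{x \<in> X. x - int i * q \<in> A \<and> x - int i' * q \<in> A}
                 = (\<lambda>y. y + int i' * q) ` {y \<in> A. y + a \<in> A}"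
    proof -
      have "x - int i' * q + a = x - int i * q" for x
        by (simp add: a_def algebra_simps)
      moreover have "y + int i' * q \<in> X" if "y \<in> A" for y
        using shift_bound that \<open>i' < K\<close> by simp
      ultimately have "{x \<in> X. x - int i * q \<in> A \<and> x - int i' * q \<in> A}
          = {x. x - int i' * q \<in> {y \<in> A. y + a \<in> A}}"
        by (smt (verit) Collect_cong mem_Collect_eq)
      also have "\<dots> = (\<lambda>y. y + int i' * q) ` {y \<in> A. y + a \<in> A}"
        unfolding set_eq_iff image_iff
        by (metis (no_types, lifting) add_diff_cancel_right' diff_add_cancel mem_Collect_eq)
      finally show ?thesis .
    qed
    also have "card \<dots> = card {y \<in> A. y + a \<in> A}"
      by (intro card_image) (auto simp: inj_on_def)
    finally have eq: "(\<Sum>x\<in>X. I i x * I i' x) = real (card {y \<in> A. y + a \<in> A})" .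
    have "1 * q \<le> a" "a \<le> int K * q"
      unfolding a_def using that q by (intro mult_right_mono; simp)+
    then have "4 * N * int (card {x \<in> A. x + a \<in> A}) < (int (card A))\<^sup>2"
      using few by simp
    then have "real_of_int (4 * N * int (card {x \<in> A. x + a \<in> A})) < real_of_int ((int (card A))\<^sup>2)"
      by (simp only: of_int_less_iff)
    then show ?thesis
      unfolding eq n_def using N by (simp add: field_simps)
  qed
  have overlap: "(\<Sum>x\<in>X. I i x * I i' x) \<le> n\<^sup>2 / (4 * N)" if "i \<noteq> i'" "i < K" "i' < K" for i i'
    using overlap_less[of i i'] overlap_less[of i' i] that
    by (cases "i < i'") (simp_all add: mult.commute)
  have diag: "(\<Sum>x\<in>X. I i x * I i x) = n" if "i < K" for i
    using sum_I[OF that] by (simp add: I_def flip: of_bool_conj)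
  \<comment> \<open>Bound the number of pairs of translates that share a point, counted with multiplicity,
    from below by the Cauchy-Schwarz inequality and from above by \<open>overlap\<close>.\<close>
  have "(K * n)\<^sup>2 = (\<Sum>x\<in>X. \<Sum>i<K. I i x)\<^sup>2"
    by (subst sum.swap) (simp add: sum_I)
  also have "\<dots> \<le> (\<Sum>x\<in>X. (\<Sum>i<K. I i x)\<^sup>2) * card X"
    by (rule sum_squared_le_sum_of_squares)
  also have "(\<Sum>x\<in>X. (\<Sum>i<K. I i x)\<^sup>2) = (\<Sum>x\<in>X. \<Sum>i<K. \<Sum>i'<K. I i x * I i' x)"
    by (simp add: power2_eq_square sum_product)
  also have "\<dots> = (\<Sum>i<K. \<Sum>i'<K. \<Sum>x\<in>X. I i x * I i' x)"
    by (subst sum.swap, rule sum.cong[OF refl], subst sum.swap) simp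
  also have "\<dots> \<le> (\<Sum>i<K. n + (real K - 1) * (n\<^sup>2 / (4 * N)))"
  proof (rule sum_mono)
    fix i assume i: "i \<in> {..<K}"
    have "(\<Sum>i'<K. \<Sum>x\<in>X. I i x * I i' x)
        = (\<Sum>x\<in>X. I i x * I i x) + (\<Sum>i'\<in>{..<K} - {i}. \<Sum>x\<in>X. I i x * I i' x)"
      using i by (simp add: sum.remove)
    also have "\<dots> \<le> n + (\<Sum>i'\<in>{..<K} - {i}. n\<^sup>2 / (4 * N))"
      using i by (intro add_mono sum_mono overlap) (auto simp: diag)
    also have "\<dots> = n + (real K - 1) * (n\<^sup>2 / (4 * N))"
      using i by (simp add: of_nat_diff)
    finally show "(\<Sum>i'<K. \<Sum>x\<in>X. I i x * I i' x) \<le> n + (real K - 1) * (n\<^sup>2 / (4 * N))" .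
  qed
  finally have main: "(K * n)\<^sup>2 \<le> K * (n + (real K - 1) * (n\<^sup>2 / (4 * N))) * (2 * N)"
    using N by (simp add: X_def mult_right_mono)
  have dense': "4 * real_of_int N \<le> K * n"
  proof -
    have "real_of_int (4 * N) \<le> real_of_int (int K * int (card A))"
      using dense by (simp only: of_int_le_iff)
    then show ?thesis
      by (simp add: n_def)
  qed
  have "0 < 4 * real_of_int N"
    using N by simp
  with dense' have "0 < K * n"
    by linarith
  then have pos: "real K > 0" "n > 0"
    by (simp_all add: n_def zero_less_mult_iff)
  have eq: "K * (n + (real K - 1) * (n\<^sup>2 / (4 * N))) * (2 * N) = K * n * (2 * N + (real K - 1) * n / 2)"
    using N by (simp add: field_simps power2_eq_square)
  have "K * n * (K * n) \<le> K * n * (2 * N + (real K - 1) * n / 2)"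
    using main unfolding eq by (simp only: power2_eq_square)
  then have "K * n \<le> 2 * N + (real K - 1) * n / 2"
    using \<open>K * n > 0\<close> by (simp only: mult_le_cancel_left_pos)
  with dense' pos show False
    by (simp add: field_simps)
qed

text \<open>
  Iterating the popular difference turns density \<open>\<delta>\<close> into density \<open>\<delta>\<^sup>2 / 4\<close>, so that after
  \<open>l\<close> steps \<open>\<delta>\<close> is still at least \<open>4 / b l ^ 3\<close> with \<open>b l = 2 ^ 2 ^ l\<close>. Taking the \<open>l\<close>-th difference
  between \<open>b l ^ 18\<close> and \<open>b l ^ 21\<close> leaves room for the required density and makes it dominate the
  sum of its predecessors, which is at most \<open>b l ^ 11\<close>. The factor \<open>2 ^ (2 * j + 7)\<close> is what the
  error analysis of the products of cosines requires.
\<close>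

lemma lacunary_cube:
  fixes A :: "int set" and N :: int and m :: nat
  assumes A: "A \<subseteq> {0..<N}" and N: "0 < N" and dense: "N \<le> 2 * int (card A)"
    and small: "m = 0 \<or> (2 ^ 2 ^ m) ^ 21 \<le> N"
  obtains a :: "nat \<Rightarrow> int" and x :: int
  where "\<And>j. j < m \<Longrightarrow> 0 < a j"
    and "\<And>j. j < m \<Longrightarrow> 2 ^ (2 * j + 7) * (\<Sum>i<j. a i) \<le> a j"
    and "\<And>T. T \<subseteq> {..<m} \<Longrightarrow> x + (\<Sum>j\<in>T. a j) \<in> A"
proof -
  define b :: "nat \<Rightarrow> int" where "b = (\<lambda>j. 2 ^ 2 ^ j)"
  have b_ge: "b j \<ge> 2 ^ (j + 1)" for j
  proof -
    have "j + 1 \<le> 2 ^ j"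
      by (simp add: Suc_le_eq)
    then show ?thesis
      unfolding b_def by (intro power_increasing) auto
  qed
  have b2: "b j \<ge> 2" for j
    using b_ge[of j] by (rule order.trans[rotated]) simp
  have b_Suc: "b (Suc j) = b j ^ 2" for j
    by (simp add: b_def power_mult[symmetric] mult.commute)
  have b_mono: "b i \<le> b j" if "i \<le> j" for i j
    using that by (simp add: b_def power_increasing)
  have "\<exists>a A'. A' \<subseteq> {0..<N} \<and> 4 * N \<le> int (card A') * b l ^ 3 \<and>
          (\<forall>j<l. 0 < a j \<and> 2 ^ (2 * j + 7) * (\<Sum>i<j. a i) \<le> a j) \<and>
          (\<Sum>i<l. a i) \<le> b l ^ 11 \<and>
          (\<forall>x\<in>A'. \<forall>T\<subseteq>{..<l}. x + (\<Sum>j\<in>T. a j) \<in> A)" if "l \<le> m" for l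
    using that
  proof (induction l)
    case 0
    show ?case
      using A dense by (intro exI[of _ "\<lambda>_. 0"] exI[of _ A]) (simp add: b_def)
  next
    case (Suc l)
    from Suc.IH[OF Suc_leD[OF Suc.prems]] obtain a A'
      where IH: "A' \<subseteq> {0..<N} \<and> 4 * N \<le> int (card A') * b l ^ 3 \<and>
          (\<forall>j<l. 0 < a j \<and> 2 ^ (2 * j + 7) * (\<Sum>i<j. a i) \<le> a j) \<and>
          (\<Sum>i<l. a i) \<le> b l ^ 11 \<and>
          (\<forall>x\<in>A'. \<forall>T\<subseteq>{..<l}. x + (\<Sum>j\<in>T. a j) \<in> A)"
      by (elim exE)
    then have A': "A' \<subseteq> {0..<N}" "4 * N \<le> int (card A') * b l ^ 3"
      and lac: "\<And>j. j < l \<Longrightarrow> 0 < a j \<and> 2 ^ (2 * j + 7) * (\<Sum>i<j. a i) \<le> a j"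
      and sum: "(\<Sum>i<l. a i) \<le> b l ^ 11"
      and cube: "\<And>x T. x \<in> A' \<Longrightarrow> T \<subseteq> {..<l} \<Longrightarrow> x + (\<Sum>j\<in>T. a j) \<in> A"
      by simp_all
    \<comment> \<open>As \<open>A'\<close> has at least \<open>4 * N / b l ^ 3\<close> elements, this many translates suffice.\<close>
    define K where "K = nat (b l ^ 3)"
    have K: "int K = b l ^ 3"
      using b2[of l] by (simp add: K_def)
    have "int K * b l ^ 18 = b l ^ 21"
      by (simp add: K flip: power_add)
    also have "\<dots> \<le> b m ^ 21"
      using Suc.prems b2[of l] by (intro power_mono b_mono) auto
    also have "\<dots> \<le> N"
      using small Suc.prems by (auto simp: b_def)
    finally have Kq: "int K * b l ^ 18 \<le> N" .
    obtain c where c: "b l ^ 18 \<le> c" "c \<le> int K * b l ^ 18"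
      and card_c: "(int (card A'))\<^sup>2 \<le> 4 * N * int (card {x \<in> A'. x + c \<in> A'})"
      using dense_set_has_popular_difference[OF A'(1) N _ Kq] A'(2) b2[of l]
      by (fastforce simp: K mult.commute)
    define A'' where "A'' = {x \<in> A'. x + c \<in> A'}"
    define a' where "a' = a(l := c)"
    have a'_sum: "(\<Sum>i<j. a' i) = (\<Sum>i<j. a i)" if "j \<le> l" for j
      unfolding a'_def using that by (intro sum.cong) auto
    have c_pos: "0 < c"
      using c(1) b2[of l] by (smt (verit) zero_less_power)
    have "A'' \<subseteq> {0..<N}"
      using A' by (auto simp: A''_def)
    moreover have "4 * N \<le> int (card A'') * b (Suc l) ^ 3"
    proof -
      have "(4 * N)\<^sup>2 \<le> (int (card A') * b l ^ 3)\<^sup>2"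
        using A'(2) N by (intro power_mono) auto
      also have "\<dots> = (int (card A'))\<^sup>2 * b l ^ 6"
        by (simp add: power_mult_distrib flip: power_mult)
      also have "\<dots> \<le> (4 * N * int (card A'')) * b l ^ 6"
        using card_c b2[of l] by (intro mult_right_mono) (auto simp: A''_def)
      finally have "4 * N * (4 * N) \<le> 4 * N * (int (card A'') * b l ^ 6)"
        by (simp add: power2_eq_square mult_ac)
      then show ?thesis
        using N by (simp add: b_Suc flip: power_mult)
    qed
    moreover have "0 < a' j \<and> 2 ^ (2 * j + 7) * (\<Sum>i<j. a' i) \<le> a' j" if "j < Suc l" for j
    proof (cases "j = l")
      case False
      then show ?thesis
        using that lac[of j] a'_sum[of j] by (simp add: a'_def)
    next
      case True
      have "(2::int) ^ (2 * l + 7) \<le> (2 ^ (l + 1)) ^ 7"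
        unfolding power_mult[symmetric] by (intro power_increasing) auto
      also have "\<dots> \<le> b l ^ 7"
        by (intro power_mono b_ge) auto
      finally have "2 ^ (2 * l + 7) * (\<Sum>i<l. a i) \<le> b l ^ 7 * b l ^ 11"
        using sum b2[of l] lac by (intro mult_mono sum_nonneg) (auto simp: less_imp_le)
      then show ?thesis
        using c c_pos True a'_sum[of l] by (simp add: a'_def flip: power_add)
    qed
    moreover have "(\<Sum>i<Suc l. a' i) \<le> b (Suc l) ^ 11"
    proof -
      have "(\<Sum>i<Suc l. a' i) \<le> b l ^ 11 + b l ^ 21"
        using sum c a'_sum[of l] by (simp add: a'_def K flip: power_add)
      also have "\<dots> \<le> b l ^ 21 + b l ^ 21"
        using b2[of l] by (intro add_right_mono power_increasing) auto
      also have "\<dots> \<le> b l * b l ^ 21"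
        using mult_right_mono[OF b2[of l], of "b l ^ 21"] b2[of l] by simp
      finally show ?thesis
        by (simp add: b_Suc flip: power_mult power_Suc)
    qed
    moreover have "x + (\<Sum>j\<in>T. a' j) \<in> A" if x: "x \<in> A''" and T: "T \<subseteq> {..<Suc l}" for x T
    proof (cases "l \<in> T")
      case False
      then have "T \<subseteq> {..<l}"
        using T by (auto simp: less_Suc_eq)
      moreover from False have "(\<Sum>j\<in>T. a' j) = (\<Sum>j\<in>T. a j)"
        by (intro sum.cong) (auto simp: a'_def)
      ultimately show ?thesis
        using cube x by (simp add: A''_def)
    next
      case True
      have "T - {l} \<subseteq> {..<l}"
        using T by (auto simp: less_Suc_eq)
      moreover have "(\<Sum>j\<in>T. a' j) = c + (\<Sum>j\<in>T - {l}. a j)"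
        using True T finite_subset[OF T]
        by (simp add: sum.remove a'_def cong: sum.cong_simp)
      ultimately show ?thesis
        using cube[of "x + c" "T - {l}"] x by (simp add: A''_def add.assoc)
    qed
    ultimately show ?case
      by blast
  qed
  from this[OF order.refl] obtain a A'
    where "A' \<subseteq> {0..<N} \<and> 4 * N \<le> int (card A') * b m ^ 3 \<and>
          (\<forall>j<m. 0 < a j \<and> 2 ^ (2 * j + 7) * (\<Sum>i<j. a i) \<le> a j) \<and>
          (\<Sum>i<m. a i) \<le> b m ^ 11 \<and>
          (\<forall>x\<in>A'. \<forall>T\<subseteq>{..<m}. x + (\<Sum>j\<in>T. a j) \<in> A)"
    by (elim exE)
  then have A': "4 * N \<le> int (card A') * b m ^ 3"
    and lac: "\<And>j. j < m \<Longrightarrow> 0 < a j \<and> 2 ^ (2 * j + 7) * (\<Sum>i<j. a i) \<le> a j"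
    and cube: "\<And>x T. x \<in> A' \<Longrightarrow> T \<subseteq> {..<m} \<Longrightarrow> x + (\<Sum>j\<in>T. a j) \<in> A"
    by simp_all
  have "A' \<noteq> {}"
    using A' N by auto
  then obtain x where "x \<in> A'"
    by blast
  with lac cube show thesis
    by (intro that) auto
qed

text \<open>
  The lines in direction \<open>i\<close> partition the box of side \<open>N\<close> and are indexed by their base points,
  whose coordinate \<open>i\<close> is \<open>0\<close>. If each of them had more than \<open>N / 2\<close> points in \<open>\<Xi>\<close>, then \<open>\<Xi>\<close> would
  contain more than half of the box.
\<close>

lemma line_with_few_points:
  fixes \<Xi> :: "(int ^ 'd::finite) set" and i :: 'd and N :: nat
  assumes fin: "finite \<Xi>" and card: "2 * card \<Xi> \<le> N ^ CARD('d)" and N: "0 < N"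
  obtains \<zeta> :: "int ^ 'd"
  where "\<zeta> $ i = 0" and "\<And>j. 0 \<le> \<zeta> $ j" and "\<And>j. \<zeta> $ j < N"
    and "N \<le> 2 * card {t \<in> {0..<int N}. \<zeta> + axis i t \<notin> \<Xi>}"
proof -
  define L where "L = PiE (UNIV - {i}) (\<lambda>_. {0..<int N})"
  define \<zeta> where "\<zeta> = (\<lambda>g. (\<chi> j. if j = i then 0 else g j) :: int ^ 'd)"
  define bad where "bad = (\<lambda>g. {t \<in> {0..<int N}. \<zeta> g + axis i t \<in> \<Xi>})"
  have fin_L: "finite L"
    unfolding L_def by (intro finite_PiE) auto
  have fin_bad: "finite (bad g)" for g
    unfolding bad_def by (rule finite_subset[of _ "{0..<int N}"]) auto
  have card_L: "card L = N ^ (CARD('d) - 1)"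
    by (simp add: L_def card_PiE card_Diff_singleton)
  have inj: "inj_on (\<lambda>(g, t). \<zeta> g + axis i t) (SIGMA g:L. bad g)"
  proof (rule inj_onI)
    fix u v assume uv: "u \<in> (SIGMA g:L. bad g)" "v \<in> (SIGMA g:L. bad g)"
      and eq: "(\<lambda>(g, t). \<zeta> g + axis i t) u = (\<lambda>(g, t). \<zeta> g + axis i t) v"
    obtain g t where u: "u = (g, t)" by (cases u)
    obtain g' t' where v: "v = (g', t')" by (cases v)
    have g: "g \<in> L" "g' \<in> L" and eq': "\<zeta> g + axis i t = \<zeta> g' + axis i t'"
      using uv eq by (simp_all add: u v)
    have "g j = g' j" for j
    proof (cases "j = i")
      case True
      have "g i = undefined" "g' i = undefined"
        using g unfolding L_def by (auto intro: PiE_arb)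
      with True show ?thesis
        by simp
    next
      case False
      then show ?thesis
        using arg_cong[OF eq', of "\<lambda>v. v $ j"] by (simp add: \<zeta>_def axis_def)
    qed
    moreover have "t = t'"
      using arg_cong[OF eq', of "\<lambda>v. v $ i"] by (simp add: \<zeta>_def axis_def)
    ultimately show "u = v"
      by (simp add: u v fun_eq_iff)
  qed
  have "(\<Sum>g\<in>L. card (bad g)) = card (SIGMA g:L. bad g)"
    using fin_L fin_bad by simp
  also have "\<dots> \<le> card \<Xi>"
    by (rule card_inj_on_le[OF inj _ fin]) (auto simp: bad_def)
  finally have total: "2 * (\<Sum>g\<in>L. card (bad g)) \<le> N ^ CARD('d)"
    using card by linarith
  have "\<exists>g\<in>L. 2 * card (bad g) \<le> N"
  proof (rule ccontr)
    assume "\<not> ?thesis"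
    then have "(\<Sum>g\<in>L. N) < (\<Sum>g\<in>L. 2 * card (bad g))"
      using fin_L card_L N by (intro sum_strict_mono) (auto simp: not_le)
    moreover have "(\<Sum>g\<in>L. N) = N ^ CARD('d)"
      by (subst power_eq_if) (simp add: card_L)
    ultimately show False
      using total by (simp add: sum_distrib_left)
  qed
  then obtain g where g: "g \<in> L" "2 * card (bad g) \<le> N"
    by blast
  have "{t \<in> {0..<int N}. \<zeta> g + axis i t \<notin> \<Xi>} = {0..<int N} - bad g"
    by (auto simp: bad_def)
  moreover have "card ({0..<int N} - bad g) = N - card (bad g)"
    using fin_bad[of g] by (subst card_Diff_subset) (simp_all, auto simp: bad_def)
  ultimately have "N \<le> 2 * card {t \<in> {0..<int N}. \<zeta> g + axis i t \<notin> \<Xi>}"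
    using g(2) by simp
  moreover have "0 \<le> \<zeta> g $ j" "\<zeta> g $ j < N" for j
    using g(1) N by (auto simp: \<zeta>_def L_def PiE_def Pi_def)
  moreover have "\<zeta> g $ i = 0"
    by (simp add: \<zeta>_def)
  ultimately show thesis
    by (intro that[of "\<zeta> g"])
qed

section \<open>Integrals of products of lacunary factors\<close>

text \<open>
  On a short interval the Lipschitz function \<open>F\<close> may be replaced by its value at the left end point,
  once before and once after averaging \<open>g\<close>; either replacement costs \<open>L * d\<^sup>2\<close>.
\<close>

lemma integral_mult_slow_fast_cell:
  fixes F g :: "real \<Rightarrow> real"
  assumes F: "continuous_on UNIV F" "\<And>x. 0 \<le> F x" "\<And>x y. \<bar>F x - F y\<bar> \<le> L * \<bar>x - y\<bar>"
    and g: "continuous_on UNIV g" "\<And>x. 0 \<le> g x"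
    and \<mu>: "0 \<le> \<mu>" "\<mu> \<le> 1" and d: "0 \<le> d"
    and mean: "integral {c..c + d} g \<le> \<mu> * d"
  shows "integral {c..c + d} (\<lambda>x. F x * g x) \<le> \<mu> * integral {c..c + d} F + 2 * L * d\<^sup>2"
proof -
  have [intro]: "F integrable_on {c..c + d}" "(\<lambda>x. C * g x) integrable_on {c..c + d}"
    "(\<lambda>x. F x * g x) integrable_on {c..c + d}" for C
    using F(1) g(1)
    by (auto intro!: integrable_continuous_interval continuous_on_mult intro: continuous_on_subset)
  have L: "0 \<le> L"
    using F(3)[of 0 1] by simp
  have near: "\<bar>F x - F c\<bar> \<le> L * d" if "x \<in> {c..c + d}" for x
  proof -
    have "L * \<bar>x - c\<bar> \<le> L * d"
      using that L by (intro mult_left_mono) auto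
    with F(3)[of x c] show ?thesis
      by linarith
  qed
  have "integral {c..c + d} (\<lambda>x. F x * g x) \<le> integral {c..c + d} (\<lambda>x. (F c + L * d) * g x)"
  proof (rule integral_le)
    fix x assume "x \<in> {c..c + d}"
    from near[OF this] show "F x * g x \<le> (F c + L * d) * g x"
      using g(2)[of x] by (intro mult_right_mono) auto
  qed auto
  also have "\<dots> = (F c + L * d) * integral {c..c + d} g"
    by simp
  also have "\<dots> \<le> (F c + L * d) * (\<mu> * d)"
    using mean F(2)[of c] L d by (intro mult_left_mono) auto
  also have "\<dots> = \<mu> * (F c * d) + \<mu> * (L * d\<^sup>2)"
    by (simp add: algebra_simps power2_eq_square)
  also have "F c * d \<le> integral {c..c + d} F + L * d\<^sup>2"
  proof -
    have "integral {c..c + d} (\<lambda>x. F c - L * d) \<le> integral {c..c + d} F"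
    proof (rule integral_le)
      fix x assume "x \<in> {c..c + d}"
      from near[OF this] show "F c - L * d \<le> F x"
        by linarith
    qed auto
    then show ?thesis
      using d by (simp add: algebra_simps power2_eq_square)
  qed
  finally have "integral {c..c + d} (\<lambda>x. F x * g x)
      \<le> \<mu> * (integral {c..c + d} F + L * d\<^sup>2) + \<mu> * (L * d\<^sup>2)"
    using \<mu> by (simp add: mult_left_mono)
  also have "\<dots> = \<mu> * integral {c..c + d} F + 2 * (\<mu> * (L * d\<^sup>2))"
    by (simp add: algebra_simps)
  also have "\<mu> * (L * d\<^sup>2) \<le> 1 * (L * d\<^sup>2)"
    using \<mu> L by (intro mult_right_mono) auto
  finally show ?thesis
    by (simp add: mult.assoc)
qed

text \<open>
  Approximate independence of a slowly varying \<open>F\<close> and of a \<open>g\<close> that has mean at most \<open>\<mu>\<close> over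
  each interval of length \<open>2 * pi / q\<close>: cut \<open>{0..2 * pi}\<close> into \<open>q\<close> cells.
\<close>

lemma integral_mult_slow_fast:
  fixes F g :: "real \<Rightarrow> real" and q :: nat
  assumes F: "continuous_on UNIV F" "\<And>x. 0 \<le> F x" "\<And>x y. \<bar>F x - F y\<bar> \<le> L * \<bar>x - y\<bar>"
    and g: "continuous_on UNIV g" "\<And>x. 0 \<le> g x"
    and \<mu>: "0 \<le> \<mu>" "\<mu> \<le> 1" and q: "0 < q"
    and mean: "\<And>c. integral {c..c + 2 * pi / q} g \<le> \<mu> * (2 * pi / q)"
  shows "integral {0..2 * pi} (\<lambda>x. F x * g x) \<le> \<mu> * integral {0..2 * pi} F + 2 * pi * (16 * L / q)"
proof -
  define d where "d = 2 * pi / q"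
  have d: "0 \<le> d"
    by (simp add: d_def)
  have integrable: "F integrable_on {a..b}" "(\<lambda>x. F x * g x) integrable_on {a..b}" for a b
    using F(1) g(1)
    by (auto intro!: integrable_continuous_interval continuous_on_mult intro: continuous_on_subset)
  have L: "0 \<le> L"
    using F(3)[of 0 1] by simp
  have "integral {0..l * d} (\<lambda>x. F x * g x) \<le> \<mu> * integral {0..l * d} F + l * (2 * L * d\<^sup>2)" for l :: nat
  proof (induction l)
    case (Suc l)
    have split: "integral {0..Suc l * d} f = integral {0..l * d} f + integral {l * d..l * d + d} f"
      if "\<And>a b. f integrable_on {a..b}" for f :: "real \<Rightarrow> real"
      using Henstock_Kurzweil_Integration.integral_combine[of 0 "l * d" "Suc l * d" f] that d
      by (simp add: algebra_simps)
    have "integral {l * d..l * d + d} (\<lambda>x. F x * g x)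
        \<le> \<mu> * integral {l * d..l * d + d} F + 2 * L * d\<^sup>2"
      using assms d by (intro integral_mult_slow_fast_cell) (auto simp: d_def)
    with Suc.IH show ?case
      unfolding split[OF integrable(1)] split[OF integrable(2)]
      by (simp add: algebra_simps)
  qed simp
  from this[of q] have "integral {0..2 * pi} (\<lambda>x. F x * g x)
      \<le> \<mu> * integral {0..2 * pi} F + q * (2 * L * d\<^sup>2)"
    using q by (simp add: d_def)
  also have "q * (2 * L * d\<^sup>2) = 2 * pi * (4 * pi * L / q)"
    using q by (simp add: d_def field_simps power2_eq_square)
  also have "\<dots> \<le> 2 * pi * (16 * L / q)"
    using pi_less_4 L by (intro mult_left_mono divide_right_mono mult_right_mono) auto
  finally show ?thesis
    by simp
qed

lemma abs_prod_diff_le_lipschitz: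
  fixes g :: "nat \<Rightarrow> real \<Rightarrow> real"
  assumes "\<And>j x. j < m \<Longrightarrow> 0 \<le> g j x \<and> g j x \<le> 1"
    and "\<And>j x y. j < m \<Longrightarrow> \<bar>g j x - g j y\<bar> \<le> a j * \<bar>x - y\<bar>"
  shows "\<bar>(\<Prod>j<m. g j x) - (\<Prod>j<m. g j y)\<bar> \<le> (\<Sum>j<m. a j) * \<bar>x - y\<bar>"
proof -
  have "norm ((\<Prod>j<m. g j x) - (\<Prod>j<m. g j y)) \<le> (\<Sum>j<m. norm (g j x - g j y))"
    using assms(1) by (intro norm_prod_diff) auto
  also have "\<dots> \<le> (\<Sum>j<m. a j * \<bar>x - y\<bar>)"
    using assms(2) by (intro sum_mono) auto
  finally show ?thesis
    by (simp add: sum_distrib_right)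
qed

text \<open>
  Factors with frequencies \<open>a j\<close>, of which each one is much faster than all its predecessors
  together.
\<close>

locale lacunary_factors =
  fixes m :: nat and a :: "nat \<Rightarrow> nat" and g :: "nat \<Rightarrow> real \<Rightarrow> real"
  assumes a_pos: "j < m \<Longrightarrow> 0 < a j"
    and lacunary: "j < m \<Longrightarrow> 2 ^ (2 * j + 7) * (\<Sum>i<j. a i) \<le> a j"
    and g_cont: "j < m \<Longrightarrow> continuous_on UNIV (g j)"
    and g_bounds: "\<And>x::real. j < m \<Longrightarrow> 0 \<le> g j x \<and> g j x \<le> 1"
    and g_lipschitz: "\<And>x y::real. j < m \<Longrightarrow> \<bar>g j x - g j y\<bar> \<le> a j * \<bar>x - y\<bar>"
begin

lemma prod_factors_continuous: "l \<le> m \<Longrightarrow> continuous_on UNIV (\<lambda>x. \<Prod>j<l. g j x)"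
  by (intro continuous_on_prod g_cont) auto

lemma prod_factors_nonneg: "l \<le> m \<Longrightarrow> 0 \<le> (\<Prod>j<l. g j (x::real))"
  using g_bounds by (intro prod_nonneg) auto

lemma prod_factors_lipschitz:
  fixes x y :: real
  shows "l \<le> m \<Longrightarrow> \<bar>(\<Prod>j<l. g j x) - (\<Prod>j<l. g j y)\<bar> \<le> (\<Sum>j<l. a j) * \<bar>x - y\<bar>"
  using abs_prod_diff_le_lipschitz[of l g a x y] g_bounds g_lipschitz by simp

text \<open>
  The error of decoupling the factor with index \<open>l\<close>. It is compared with \<open>(1 / 2) ^ Suc l\<close>, a lower
  bound for \<open>\<mu> ^ Suc l\<close> if \<open>1 / 2 \<le> \<mu>\<close>, and the remaining factors \<open>(1 / 2) ^ (l + 2)\<close> have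
  sum at most \<open>1 / 2\<close>. Hence the bounds for the product lose only constant factors.
\<close>

lemma lacunary_error:
  assumes "l < m"
  shows "16 * real (\<Sum>j<l. a j) / a l \<le> (1 / 2) ^ Suc l * (1 / 2) ^ (l + 2)"
proof -
  have "real (2 ^ (2 * l + 7) * (\<Sum>i<l. a i)) \<le> a l"
    using lacunary[OF assms] by (simp only: of_nat_le_iff)
  then have "2 ^ (2 * l + 3) * (16 * real (\<Sum>j<l. a j)) \<le> a l"
    by (simp add: power_add)
  then have "16 * real (\<Sum>j<l. a j) / a l \<le> 1 / 2 ^ (2 * l + 3)"
    using a_pos[OF assms] by (simp add: field_simps)
  also have "\<dots> = (1 / 2) ^ (Suc l + (l + 2))"
    by (simp only: power_one_over) (rule arg_cong[of _ _ "\<lambda>i. 1 / 2 ^ i"], simp)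
  finally show ?thesis
    by (simp add: power_add)
qed

lemma integral_prod_upper:
  assumes mean: "\<And>j c. j < m \<Longrightarrow> integral {c..c + 2 * pi / a j} (g j) \<le> \<mu> * (2 * pi / a j)"
    and \<mu>: "1 / 2 \<le> \<mu>" "\<mu> \<le> 1"
  shows "integral {0..2 * pi} (\<lambda>x. \<Prod>j<m. g j x) \<le> 2 * pi * (3 / 2 * \<mu> ^ m)"
proof -
  \<comment> \<open>The last factor is \<open>1\<close> plus the sum of the relative errors \<open>(1 / 2) ^ (j + 2)\<close> for \<open>j < l\<close>.\<close>
  have "integral {0..2 * pi} (\<lambda>x. \<Prod>j<l. g j x) \<le> 2 * pi * (\<mu> ^ l * (3 / 2 - (1 / 2) ^ (l + 1)))"
    if "l \<le> m" for l
    using that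
  proof (induction l)
    case (Suc l)
    then have l: "l < m" "l \<le> m" by auto
    have "integral {0..2 * pi} (\<lambda>x. (\<Prod>j<l. g j x) * g l x)
        \<le> \<mu> * integral {0..2 * pi} (\<lambda>x. \<Prod>j<l. g j x) + 2 * pi * (16 * real (\<Sum>j<l. a j) / a l)"
      using l prod_factors_continuous prod_factors_nonneg prod_factors_lipschitz g_cont g_bounds mean \<mu> a_pos
      by (intro integral_mult_slow_fast) auto
    also have "\<dots> \<le> \<mu> * (2 * pi * (\<mu> ^ l * (3 / 2 - (1 / 2) ^ (l + 1))))
        + 2 * pi * (\<mu> ^ Suc l * (1 / 2) ^ (l + 2))"
    proof (intro add_mono mult_left_mono Suc.IH l)
      have "(1 / 2) ^ Suc l * (1 / 2) ^ (l + 2) \<le> \<mu> ^ Suc l * (1 / 2) ^ (l + 2)"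
        using \<mu> by (intro mult_right_mono power_mono) auto
      with lacunary_error[OF l(1)]
      show "16 * real (\<Sum>j<l. a j) / a l \<le> \<mu> ^ Suc l * (1 / 2) ^ (l + 2)"
        by linarith
    qed (use \<mu> in auto)
    also have "\<dots> = 2 * pi * (\<mu> ^ Suc l * (3 / 2 - (1 / 2) ^ (Suc l + 1)))"
      by (simp add: algebra_simps)
    finally show ?case
      by simp
  qed simp
  from this[of m] have "integral {0..2 * pi} (\<lambda>x. \<Prod>j<m. g j x)
      \<le> 2 * pi * (\<mu> ^ m * (3 / 2 - (1 / 2) ^ (m + 1)))"
    by simp
  also have "\<dots> \<le> 2 * pi * (\<mu> ^ m * (3 / 2))"
    using \<mu> by (intro mult_left_mono) auto
  finally show ?thesis
    by (simp add: mult_ac)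
qed

text \<open>
  The lower bound is the upper bound of \<open>integral_mult_slow_fast\<close> applied to \<open>1 - g l\<close>.
\<close>

lemma integral_prod_lower:
  assumes mean: "\<And>j c. j < m \<Longrightarrow> integral {c..c + 2 * pi / a j} (g j) \<ge> 1 / 2 * (2 * pi / a j)"
  shows "integral {0..2 * pi} (\<lambda>x. \<Prod>j<m. g j x) \<ge> 2 * pi * (1 / 2 * (1 / 2) ^ m)"
proof -
  \<comment> \<open>The last factor is \<open>1\<close> minus the sum of the relative errors \<open>(1 / 2) ^ (j + 2)\<close> for \<open>j < l\<close>.\<close>
  have "integral {0..2 * pi} (\<lambda>x. \<Prod>j<l. g j x) \<ge> 2 * pi * ((1 / 2) ^ l * (1 / 2 + (1 / 2) ^ (l + 1)))"
    if "l \<le> m" for l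
    using that
  proof (induction l)
    case (Suc l)
    then have l: "l < m" "l \<le> m" by auto
    define F where "F = (\<lambda>x. \<Prod>j<l. g j x)"
    have cont: "continuous_on UNIV F" "continuous_on UNIV (g l)"
      unfolding F_def using prod_factors_continuous[OF l(2)] g_cont[OF l(1)] by simp_all
    then have integrable: "F integrable_on {c..d}" "g l integrable_on {c..d}"
      "(\<lambda>x. F x * g l x) integrable_on {c..d}" for c d
      by (auto intro!: integrable_continuous_interval continuous_on_mult intro: continuous_on_subset)
    have mean': "integral {c..c + 2 * pi / a l} (\<lambda>x. 1 - g l x) \<le> 1 / 2 * (2 * pi / a l)" for c
    proof -
      have "integral {c..c + 2 * pi / a l} (\<lambda>x. 1 - g l x)
          = 2 * pi / a l - integral {c..c + 2 * pi / a l} (g l)"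
        by (subst Henstock_Kurzweil_Integration.integral_diff[OF _ integrable(2)])
          (simp_all add: integrable_const_ivl)
      then show ?thesis
        using mean[OF l(1), of c] by linarith
    qed
    define R where "R = 2 * pi * ((1 / 2) ^ Suc l * (1 / 2) ^ (l + 2))"
    have "integral {0..2 * pi} (\<lambda>x. F x * (1 - g l x))
        \<le> 1 / 2 * integral {0..2 * pi} F + 2 * pi * (16 * real (\<Sum>j<l. a j) / a l)"
    proof (rule integral_mult_slow_fast)
      show "continuous_on UNIV F" "continuous_on UNIV (\<lambda>x. 1 - g l x)"
        using l unfolding F_def by (auto intro!: prod_factors_continuous g_cont continuous_on_diff)
      show "0 \<le> F x" "0 \<le> 1 - g l x" "\<bar>F x - F y\<bar> \<le> real (\<Sum>j<l. a j) * \<bar>x - y\<bar>" for x y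
        using l prod_factors_nonneg[of l x] g_bounds[of l x] prod_factors_lipschitz[of l x y]
        unfolding F_def by simp_all
      show "0 < a l"
        using a_pos l by simp
    qed (use mean' in auto)
    moreover have "2 * pi * (16 * real (\<Sum>j<l. a j) / a l) \<le> R"
      unfolding R_def using lacunary_error[OF l(1)] by (intro mult_left_mono) auto
    moreover have "integral {0..2 * pi} (\<lambda>x. F x * (1 - g l x))
        = integral {0..2 * pi} F - integral {0..2 * pi} (\<lambda>x. F x * g l x)"
      using integrable
      by (subst Henstock_Kurzweil_Integration.integral_diff[symmetric]) (auto simp: algebra_simps)
    ultimately have h1: "1 / 2 * integral {0..2 * pi} F - R \<le> integral {0..2 * pi} (\<lambda>x. F x * g l x)"
      by linarith
    have h2: "1 / 2 * (2 * pi * ((1 / 2) ^ l * (1 / 2 + (1 / 2) ^ (l + 1))))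
        \<le> 1 / 2 * integral {0..2 * pi} F"
      unfolding F_def by (intro mult_left_mono Suc.IH l) auto
    have h3: "2 * pi * ((1 / 2) ^ Suc l * (1 / 2 + (1 / 2) ^ (Suc l + 1)))
        = 1 / 2 * (2 * pi * ((1 / 2) ^ l * (1 / 2 + (1 / 2) ^ (l + 1)))) - R"
      unfolding R_def by (simp add: algebra_simps)
    have "2 * pi * ((1 / 2) ^ Suc l * (1 / 2 + (1 / 2) ^ (Suc l + 1)))
        \<le> integral {0..2 * pi} (\<lambda>x. F x * g l x)"
      unfolding h3 using diff_right_mono[OF h2, of R] h1 by (rule order.trans)
    then show ?case
      by (simp add: F_def)
  qed simp
  from this[of m] have "2 * pi * ((1 / 2) ^ m * (1 / 2 + (1 / 2) ^ (m + 1)))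
      \<le> integral {0..2 * pi} (\<lambda>x. \<Prod>j<m. g j x)"
    by simp
  moreover have "2 * pi * (1 / 2 * (1 / 2) ^ m) \<le> 2 * pi * ((1 / 2) ^ m * (1 / 2 + (1 / 2) ^ (m + 1)))"
    by (subst mult.commute[of "1 / 2"], intro mult_left_mono) auto
  ultimately show ?thesis
    by (rule order.trans[rotated])
qed

end

lemma abs_cos_diff_le: "\<bar>cos x - cos y\<bar> \<le> \<bar>x - y\<bar>" for x y :: real
proof -
  have "\<bar>cos x - cos y\<bar> = 2 * \<bar>sin ((x + y) / 2)\<bar> * \<bar>sin ((y - x) / 2)\<bar>"
    by (simp add: cos_diff_cos abs_mult)
  also have "\<dots> \<le> 2 * 1 * \<bar>(y - x) / 2\<bar>"
    by (intro mult_mono abs_sin_x_le_abs_x abs_sin_le_one) auto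
  finally show ?thesis
    by simp
qed

text \<open>
  An interval of this length contains a zero \<open>z\<close> of the cosine, and the sign is constant on either
  side of \<open>z\<close>.
\<close>

lemma integral_abs_cos_half_period:
  fixes q :: nat and c \<theta> :: real
  assumes q: "0 < q"
  shows "integral {c..c + 2 * pi / q} (\<lambda>x. \<bar>cos ((q * x + \<theta>) / 2)\<bar>) = 2 / pi * (2 * pi / q)"
proof -
  define k where "k = \<lceil>(q * c + \<theta> - pi) / (2 * pi)\<rceil>"
  define z where "z = (pi + 2 * pi * k - \<theta>) / q"
  have k: "(q * c + \<theta> - pi) / (2 * pi) \<le> k" "k \<le> (q * c + \<theta> - pi) / (2 * pi) + 1"
    unfolding k_def by linarith+
  then have "q * c + \<theta> - pi \<le> 2 * pi * k" "2 * pi * k \<le> q * c + \<theta> - pi + 2 * pi"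
    by (simp_all add: field_simps)
  then have "c * q \<le> pi + 2 * pi * k - \<theta>" "pi + 2 * pi * k - \<theta> \<le> (c + 2 * pi / q) * q"
    using q by (simp_all add: algebra_simps)
  then have z: "c \<le> z" "z \<le> c + 2 * pi / q"
    unfolding z_def using q by (simp_all only: pos_le_divide_eq pos_divide_le_eq of_nat_0_less_iff)
  have *: "(q * x + \<theta>) / 2 = q * (x - z) / 2 + (pi / 2 + pi * k)" for x :: real
    using q by (simp add: z_def field_simps)
  have abs_cos: "\<bar>cos ((q * x + \<theta>) / 2)\<bar> = \<bar>sin (q * (x - z) / 2)\<bar>" for x :: real
  proof -
    have "\<bar>cos (y + (pi / 2 + pi * k))\<bar> = \<bar>sin y\<bar>" for y :: real
    proof -
      have "cos (y + (pi / 2 + pi * k)) = - (sin y * cos (pi * k))"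
        by (simp add: cos_add sin_add)
      also have "\<bar>\<dots>\<bar> = \<bar>sin y\<bar>"
        by (simp add: abs_mult cos_npi_int)
      finally show ?thesis
        by simp
    qed
    then show ?thesis
      by (simp only: *)
  qed
  define G where "G = (\<lambda>x::real. 2 / q * cos (q * (x - z) / 2))"
  have G': "(G has_real_derivative - sin (q * (x - z) / 2)) (at x within S)" for x :: real and S
    unfolding G_def using q by (auto intro!: derivative_eq_intros)
  have i1: "((\<lambda>x. - sin (q * (x - z) / 2)) has_integral (G z - G c)) {c..z}"
    using z G' by (intro fundamental_theorem_of_calculus)
      (auto simp: has_real_derivative_iff_has_vector_derivative)
  have e1: "- sin (q * (x - z) / 2) = \<bar>cos ((q * x + \<theta>) / 2)\<bar>" if "x \<in> {c..z}" for x :: real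
  proof -
    have "q * (z - x) \<le> q * (2 * pi / q)"
      using that z q by (intro mult_left_mono) auto
    then have "0 \<le> sin (q * (z - x) / 2)"
      using that q by (intro sin_ge_zero) auto
    moreover have "sin (q * (x - z) / 2) = - sin (q * (z - x) / 2)"
      by (simp add: algebra_simps minus_divide_left flip: sin_minus)
    ultimately show ?thesis
      by (simp add: abs_cos)
  qed
  have 1: "((\<lambda>x. \<bar>cos ((q * x + \<theta>) / 2)\<bar>) has_integral (G z - G c)) {c..z}"
    by (intro has_integral_eq[OF _ i1] e1)
  have i2: "((\<lambda>x. - (- sin (q * (x - z) / 2))) has_integral - (G (c + 2 * pi / q) - G z)) {z..c + 2 * pi / q}"
    using z G' by (intro has_integral_neg fundamental_theorem_of_calculus)
      (auto simp: has_real_derivative_iff_has_vector_derivative)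
  have e2: "- (- sin (q * (x - z) / 2)) = \<bar>cos ((q * x + \<theta>) / 2)\<bar>" if "x \<in> {z..c + 2 * pi / q}" for x :: real
  proof -
    have "q * (x - z) \<le> q * (2 * pi / q)"
      using that z q by (intro mult_left_mono) auto
    then have "0 \<le> sin (q * (x - z) / 2)"
      using that q by (intro sin_ge_zero) auto
    then show ?thesis
      by (simp add: abs_cos)
  qed
  have 2: "((\<lambda>x. \<bar>cos ((q * x + \<theta>) / 2)\<bar>) has_integral - (G (c + 2 * pi / q) - G z)) {z..c + 2 * pi / q}"
    by (intro has_integral_eq[OF _ i2] e2)
  have "G (c + 2 * pi / q) = - G c"
  proof -
    have "q * (c + 2 * pi / q - z) / 2 = q * (c - z) / 2 + pi"
      using q by (simp add: field_simps)
    then show ?thesis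
      unfolding G_def by (simp only: cos_periodic_pi)
  qed
  moreover have "G z = 2 / q"
    by (simp add: G_def)
  ultimately have "G z - G c + - (G (c + 2 * pi / q) - G z) = 2 / pi * (2 * pi / q)"
    by simp
  with has_integral_combine[OF z 1 2] show ?thesis
    by (simp add: integral_unique)
qed

lemma integral_cos_half_squared_period:
  fixes q :: nat and c :: real
  assumes q: "0 < q"
  shows "integral {c..c + 2 * pi / q} (\<lambda>x. (cos (q * x / 2))\<^sup>2) = 1 / 2 * (2 * pi / q)"
proof -
  define G where "G = (\<lambda>x::real. x / 2 + sin (q * x) / (2 * q))"
  have "(G has_real_derivative (cos (q * x / 2))\<^sup>2) (at x within S)" for x :: real and S
  proof -
    have "cos (q * x) = 2 * (cos (q * x / 2))\<^sup>2 - 1"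
      using cos_double_cos[of "q * x / 2"] by simp
    moreover have "(G has_real_derivative (1 / 2 + cos (q * x) * q / (2 * q))) (at x within S)"
      unfolding G_def using q by (auto intro!: derivative_eq_intros)
    moreover have "1 / 2 + cos (q * x) * q / (2 * q) = (cos (q * x / 2))\<^sup>2"
      using q \<open>cos (q * x) = _\<close> by (simp add: field_simps)
    ultimately show ?thesis
      by simp
  qed
  then have "((\<lambda>x. (cos (q * x / 2))\<^sup>2) has_integral (G (c + 2 * pi / q) - G c)) {c..c + 2 * pi / q}"
    by (intro fundamental_theorem_of_calculus)
      (auto simp: has_real_derivative_iff_has_vector_derivative)
  moreover have "sin (q * (c + 2 * pi / q)) = sin (q * c)"
    using q by (simp add: distrib_left sin_add)
  ultimately show ?thesis
    by (simp add: integral_unique G_def field_simps)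
qed

section \<open>Integration on the torus\<close>

lemma prod_Basis_vec:
  fixes \<phi> :: "real ^ 'd::finite \<Rightarrow> 'a::comm_monoid_mult"
  shows "(\<Prod>b\<in>Basis. \<phi> b) = (\<Prod>j\<in>UNIV. \<phi> (axis j 1))"
proof -
  have "(Basis :: (real ^ 'd) set) = range (\<lambda>j. axis j 1)"
    by (auto simp: Basis_vec_def)
  moreover have "inj (\<lambda>j. axis j 1 :: real ^ 'd)"
    by (auto simp: inj_on_def axis_eq_axis)
  ultimately show ?thesis
    using prod.reindex[of "\<lambda>j. axis j 1 :: real ^ 'd" UNIV \<phi>] by (simp add: comp_def)
qed

lemma emeasure_torus_cell:
  "emeasure lborel (cbox 0 (\<chi> j. 2 * pi) :: (real ^ 'd::finite) set) = ennreal ((2 * pi) ^ CARD('d))"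
proof -
  have "0 \<le> (\<chi> j. 2 * pi) \<bullet> b" if "b \<in> Basis" for b :: "real ^ 'd"
    using that by (auto simp: Basis_vec_def inner_axis)
  then show ?thesis
    by (subst emeasure_lborel_cbox) (auto simp: prod_Basis_vec inner_axis)
qed

lemma indicator_torus_cell:
  "indicator (cbox 0 (\<chi> j. 2 * pi)) x = (\<Prod>j\<in>UNIV. indicator {0..2 * pi} (x $ j) :: 'a::comm_semiring_1)"
  for x :: "real ^ 'd::finite"
proof (cases "x \<in> cbox 0 (\<chi> j. 2 * pi)")
  case True
  then show ?thesis
    by (simp add: mem_box_cart)
next
  case False
  then obtain j where "x $ j \<notin> {0..2 * pi}"
    by (auto simp: mem_box_cart)
  then have "indicator {0..2 * pi} (x $ j) = (0 :: 'a)"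
    by simp
  then have "(\<Prod>j\<in>UNIV. indicator {0..2 * pi} (x $ j) :: 'a) = 0"
    by (intro prod_zero) auto
  with False show ?thesis
    by simp
qed

lemma nn_integral_torus:
  assumes "f \<in> borel_measurable borel"
  shows "(\<integral>\<^sup>+x. f x \<partial>(torus_measure :: (real ^ 'd::finite) measure))
    = (\<integral>\<^sup>+x. f x * indicator (cbox 0 (\<chi> j. 2 * pi)) x \<partial>lborel) / ennreal ((2 * pi) ^ CARD('d))"
  unfolding torus_measure_def using assms emeasure_torus_cell[where 'd='d]
  by (subst nn_integral_uniform_measure) (auto simp: nn_integral_completion measurable_completion)

lemma integral_torus:
  fixes f :: "real ^ 'd::finite \<Rightarrow> complex"
  assumes [measurable]: "f \<in> borel_measurable borel"
  shows "(\<integral>x. f x \<partial>torus_measure)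
    = (\<integral>x. indicator (cbox 0 (\<chi> j. 2 * pi)) x * f x \<partial>lborel) / (2 * pi) ^ CARD('d)"
proof -
  define C :: "(real ^ 'd) set" where "C = cbox 0 (\<chi> j. 2 * pi)"
  define v :: real where "v = (2 * pi) ^ CARD('d)"
  have v: "0 < v" "emeasure lborel C = ennreal v"
    by (simp_all add: v_def C_def emeasure_torus_cell)
  have "torus_measure = density lebesgue (\<lambda>x. ennreal (indicator C x / v))"
    unfolding torus_measure_def uniform_measure_def C_def[symmetric]
  proof (intro density_cong AE_I2)
    show "(\<lambda>x. indicator C x / emeasure lebesgue C) \<in> borel_measurable lebesgue"
      "(\<lambda>x. ennreal (indicator C x / v)) \<in> borel_measurable lebesgue"
      by (intro measurable_completion; simp add: C_def)+
    show "indicator C x / emeasure lebesgue C = ennreal (indicator C x / v)" for x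
      using v divide_ennreal[of 1 v] by (cases "x \<in> C") (simp_all add: C_def)
  qed
  then have "(\<integral>x. f x \<partial>torus_measure) = (\<integral>x. (indicator C x / v) *\<^sub>R f x \<partial>lebesgue)"
    using v assms
    by (subst integral_density[symmetric])
       (auto intro!: measurable_completion simp: C_def)
  also have "\<dots> = (\<integral>x. (indicator C x / v) *\<^sub>R f x \<partial>lborel)"
    by (intro integral_completion) (simp add: C_def)
  also have "(\<lambda>x. (indicator C x / v) *\<^sub>R f x) = (\<lambda>x. indicator C x * f x / v)"
    by (auto simp: fun_eq_iff indicator_def scaleR_conv_of_real)
  finally show ?thesis
    by (simp add: C_def v_def)
qed

text \<open>
  Under the normalized measure every coordinate is uniformly distributed on \<open>{0..2 * pi}\<close>.
\<close>

lemma nn_integral_torus_coordinate: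
  fixes \<phi> :: "real \<Rightarrow> real" and i :: "'d::finite"
  assumes cont: "continuous_on UNIV \<phi>" and nonneg: "\<And>t. 0 \<le> \<phi> t"
  shows "(\<integral>\<^sup>+x. ennreal (\<phi> (x $ i)) \<partial>(torus_measure :: (real ^ 'd) measure))
    = ennreal (integral {0..2 * pi} \<phi> / (2 * pi))"
proof -
  have [measurable]: "\<phi> \<in> borel_measurable borel"
    by (rule borel_measurable_continuous_onI[OF cont])
  define f :: "real ^ 'd \<Rightarrow> real \<Rightarrow> real"
    where "f = (\<lambda>b t. (if b = axis i 1 then \<phi> t else 1) * indicator {0..2 * pi} t)"
  have f_prod: "(\<Prod>b\<in>Basis. f b (x \<bullet> b)) = \<phi> (x $ i) * indicator (cbox 0 (\<chi> j. 2 * pi)) x" for x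
    by (simp add: f_def prod_Basis_vec inner_axis axis_eq_axis prod.distrib indicator_torus_cell prod.delta)
  have [simp]: "f b \<in> borel_measurable borel" "0 \<le> f b t" for b t
    using nonneg by (auto simp: f_def)
  have "\<phi> integrable_on {0..2 * pi}"
    using cont by (intro integrable_continuous_interval) (auto intro: continuous_on_subset)
  then have "(\<phi> has_integral integral {0..2 * pi} \<phi>) {0..2 * pi}"
    by (rule integrable_integral)
  from nn_integral_has_integral_lebesgue'[OF nonneg this]
  have f_i: "(\<integral>\<^sup>+t. ennreal (f (axis i 1) t) \<partial>lborel) = ennreal (integral {0..2 * pi} \<phi>)"
    by (simp add: f_def ennreal_mult' ennreal_indicator nonneg)
  have f_j: "(\<integral>\<^sup>+t. ennreal (f (axis j 1) t) \<partial>lborel) = ennreal (2 * pi)" if "j \<noteq> i" for j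
    using that by (simp add: f_def axis_eq_axis ennreal_indicator)
  have "(\<integral>\<^sup>+x. ennreal (\<phi> (x $ i)) * indicator (cbox 0 (\<chi> j. 2 * pi)) x \<partial>lborel)
      = (\<integral>\<^sup>+x. (\<Prod>b\<in>Basis. f b (x \<bullet> b)) \<partial>lborel)"
    by (simp add: f_prod ennreal_mult' ennreal_indicator nonneg)
  also have "\<dots> = (\<Prod>j\<in>UNIV. \<integral>\<^sup>+t. ennreal (f (axis j 1) t) \<partial>lborel)"
    using nn_integral_lborel_prod[of f] by (simp add: prod_Basis_vec prod_ennreal)
  also have "\<dots> = ennreal (integral {0..2 * pi} \<phi>) * ennreal (2 * pi) ^ (CARD('d) - 1)"
    by (subst prod.remove[of _ i]) (simp_all add: f_i f_j card_Diff_singleton)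
  also have "\<dots> = ennreal (integral {0..2 * pi} \<phi> * (2 * pi) ^ (CARD('d) - 1))"
    using nonneg \<open>\<phi> integrable_on _\<close>
    by (subst ennreal_power) (auto simp: integral_nonneg simp flip: ennreal_mult)
  finally have "(\<integral>\<^sup>+x. ennreal (\<phi> (x $ i)) * indicator (cbox 0 (\<chi> j. 2 * pi)) x \<partial>(lborel :: (real ^ 'd) measure)) = \<dots>" .
  then have "(\<integral>\<^sup>+x. ennreal (\<phi> (x $ i)) \<partial>(torus_measure :: (real ^ 'd) measure))
      = ennreal (integral {0..2 * pi} \<phi> * (2 * pi) ^ (CARD('d) - 1)) / ennreal ((2 * pi) ^ CARD('d))"
    by (subst nn_integral_torus) simp_all
  also have "\<dots> = ennreal (integral {0..2 * pi} \<phi> * (2 * pi) ^ (CARD('d) - 1) / (2 * pi) ^ CARD('d))"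
    using nonneg \<open>\<phi> integrable_on _\<close> by (intro divide_ennreal) (auto simp: integral_nonneg)
  also have "integral {0..2 * pi} \<phi> * (2 * pi) ^ (CARD('d) - 1) / (2 * pi) ^ CARD('d) = integral {0..2 * pi} \<phi> / (2 * pi)"
    by (subst (2) power_eq_if) simp
  finally show ?thesis .
qed

lemma integral_lborel_prod:
  fixes f :: "'a::euclidean_space \<Rightarrow> real \<Rightarrow> complex"
  assumes "\<And>b. b \<in> Basis \<Longrightarrow> integrable lborel (f b)"
  shows "(\<integral>x. (\<Prod>b\<in>Basis. f b (x \<bullet> b)) \<partial>lborel) = (\<Prod>b\<in>Basis. \<integral>t. f b t \<partial>lborel)"
proof -
  interpret product_sigma_finite "\<lambda>_ :: 'a. lborel :: real measure"
    by standard
  have [measurable]: "f b \<in> borel_measurable borel" if "b \<in> Basis" for b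
    using assms[OF that] by (auto dest: borel_measurable_integrable)
  have "(\<integral>x. (\<Prod>b\<in>Basis. f b (x \<bullet> b)) \<partial>lborel)
      = (\<integral>y. (\<Prod>b\<in>Basis. f b ((\<Sum>b\<in>Basis. y b *\<^sub>R b) \<bullet> b)) \<partial>(\<Pi>\<^sub>M b\<in>(Basis :: 'a set). lborel))"
    by (subst lborel_eq, subst integral_distr) auto
  also have "\<dots> = (\<integral>y. (\<Prod>b\<in>Basis. f b (y b)) \<partial>(\<Pi>\<^sub>M b\<in>(Basis :: 'a set). lborel))"
    by (intro Bochner_Integration.integral_cong prod.cong refl) simp
  also have "\<dots> = (\<Prod>b\<in>Basis. \<integral>t. f b t \<partial>lborel)"
    by (intro product_integral_prod assms finite_Basis)
  finally show ?thesis .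
qed

lemma integral_cis_period:
  fixes n :: int
  assumes "n \<noteq> 0"
  shows "integral {0..2 * pi} (\<lambda>t. cis (n * t)) = 0"
proof -
  define F where "F = (\<lambda>z. exp (\<i> * n * z) / (\<i> * n))"
  have "(F has_field_derivative exp (\<i> * n * z)) (at z)" for z
    unfolding F_def using assms by (auto intro!: derivative_eq_intros)
  then have "((\<lambda>t. F (of_real t)) has_vector_derivative exp (\<i> * n * of_real t)) (at t within {0..2 * pi})" for t
    by (intro has_vector_derivative_real_field)
  then have "((\<lambda>t. exp (\<i> * n * of_real t)) has_integral (F (of_real (2 * pi)) - F (of_real 0))) {0..2 * pi}"
    by (intro fundamental_theorem_of_calculus) auto
  moreover have "exp (\<i> * n * of_real (2 * pi)) = 1"
    using exp_eq_1[of "\<i> * n * of_real (2 * pi)"] by auto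
  then have "F (of_real (2 * pi)) - F (of_real 0) = 0"
    by (simp add: F_def)
  ultimately have "((\<lambda>t. exp (\<i> * n * of_real t)) has_integral 0) {0..2 * pi}"
    by simp
  then show ?thesis
    by (simp add: cis_conv_exp integral_unique mult_ac)
qed

text \<open>
  The integral is a product of one-dimensional ones, and a nonzero coordinate of \<open>\<omega>\<close> makes one of
  them vanish.
\<close>

lemma integral_torus_character:
  fixes \<omega> :: "int ^ 'd::finite"
  assumes "\<omega> \<noteq> 0"
  shows "(\<integral>x. cis (\<Sum>j\<in>UNIV. real_of_int (\<omega> $ j) * x $ j) \<partial>torus_measure) = 0"
proof -
  define f :: "real ^ 'd \<Rightarrow> real \<Rightarrow> complex"
    where "f = (\<lambda>b t. indicator {0..2 * pi} t * cis ((\<Sum>j\<in>UNIV. real_of_int (\<omega> $ j) * b $ j) * t))"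
  have coeff: "(\<Sum>j\<in>UNIV. real_of_int (\<omega> $ j) * axis i 1 $ j) = real_of_int (\<omega> $ i)" for i
    by (simp add: axis_def if_distrib cong: if_cong)
  have cis_sum: "cis (\<Sum>j\<in>J. g j) = (\<Prod>j\<in>J. cis (g j))" if "finite J" for J :: "'d set" and g
    using that by (induction J rule: finite_induct) (simp_all flip: cis_mult)
  have f_prod: "(\<Prod>b\<in>Basis. f b (x \<bullet> b))
      = indicator (cbox 0 (\<chi> j. 2 * pi)) x * cis (\<Sum>j\<in>UNIV. real_of_int (\<omega> $ j) * x $ j)" for x
    by (simp add: f_def prod_Basis_vec coeff inner_axis prod.distrib indicator_torus_cell cis_sum)
  have set_int: "set_integrable lborel {0..2 * pi} (\<lambda>t. cis (c * t))" for c
    by (intro borel_integrable_atLeastAtMost' continuous_intros)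
  have f_integrable: "integrable lborel (f b)" for b
    using set_int[of "\<Sum>j\<in>UNIV. real_of_int (\<omega> $ j) * b $ j"]
    unfolding f_def set_integrable_def by (simp add: scaleR_conv_of_real of_real_indicator)
  have f_integral: "(\<integral>t. f (axis i 1) t \<partial>lborel) = integral {0..2 * pi} (\<lambda>t. cis (real_of_int (\<omega> $ i) * t))" for i
    using set_borel_integral_eq_integral(2)[OF set_int[of "real_of_int (\<omega> $ i)"]]
    by (simp add: f_def coeff set_lebesgue_integral_def scaleR_conv_of_real of_real_indicator)
  obtain i where "\<omega> $ i \<noteq> 0"
    using assms by (auto simp: vec_eq_iff)
  then have "(\<Prod>j\<in>UNIV. \<integral>t. f (axis j 1) t \<partial>lborel) = 0"
    by (intro prod_zero) (auto simp: f_integral intro!: exI[of _ i] integral_cis_period)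
  then have "(\<integral>x. (\<Prod>b\<in>Basis. f b (x \<bullet> b)) \<partial>lborel) = 0"
    using integral_lborel_prod[of f] f_integrable by (simp add: prod_Basis_vec)
  then show ?thesis
    by (subst integral_torus) (auto simp: f_prod intro!: borel_measurable_continuous_onI continuous_intros)
qed

lemma torus_Lp_norm_1:
  "torus_Lp_norm 1 f = (\<integral>\<^sup>+x. ennreal (cmod (f x)) \<partial>torus_measure)"
  by (simp add: torus_Lp_norm_def Let_def less_top)

lemma borel_measurable_torus:
  "f \<in> borel_measurable borel \<Longrightarrow> f \<in> borel_measurable torus_measure"
  by (simp add: torus_measure_def measurable_completion measurable_cong_sets[OF sets_uniform_measure refl])

lemma integrable_torus_unimodular:
  fixes f :: "real ^ 'd::finite \<Rightarrow> complex"
  assumes "continuous_on UNIV f" "\<And>x. cmod (f x) = 1"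
  shows "integrable torus_measure f"
proof (rule integrableI_bounded)
  show "f \<in> borel_measurable torus_measure"
    by (intro borel_measurable_torus borel_measurable_continuous_onI assms)
  have "(\<integral>\<^sup>+x. ennreal (norm (f x)) \<partial>torus_measure)
      = (\<integral>\<^sup>+x. ennreal ((\<lambda>_. 1) (x $ undefined)) \<partial>(torus_measure :: (real ^ 'd) measure))"
    by (simp add: assms(2))
  also have "\<dots> = ennreal 1"
    by (subst nn_integral_torus_coordinate) auto
  finally show "(\<integral>\<^sup>+x. ennreal (norm (f x)) \<partial>torus_measure) < \<infinity>"
    by simp
qed

lemma torus_Lp_norm_ge:
  assumes "0 < p" "0 \<le> r" and "ennreal (r powr p) \<le> (\<integral>\<^sup>+x. ennreal (cmod (f x) powr p) \<partial>torus_measure)"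
  shows "ennreal r \<le> torus_Lp_norm p f"
proof (cases "(\<integral>\<^sup>+x. ennreal (cmod (f x) powr p) \<partial>torus_measure) = \<infinity>")
  case False
  then obtain J where J: "(\<integral>\<^sup>+x. ennreal (cmod (f x) powr p) \<partial>torus_measure) = ennreal J" "0 \<le> J"
    by (metis ennreal_cases infinity_ennreal_def)
  then have "r powr p \<le> J"
    using assms(3) by simp
  then have "(r powr p) powr (1 / p) \<le> J powr (1 / p)"
    using assms by (intro powr_mono2) auto
  then show ?thesis
    using assms J by (simp add: torus_Lp_norm_def powr_powr)
qed (simp add: torus_Lp_norm_def)

section \<open>Norms of Riesz products\<close>

text \<open>
  The phases \<open>\<theta>\<close> and the index set \<open>S\<close> make the family closed under translations, up to constant
  factors, and under differences, up to linear combinations.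
\<close>

definition riesz_product ::
    "(nat \<Rightarrow> nat) \<Rightarrow> 'd::finite \<Rightarrow> nat set \<Rightarrow> (nat \<Rightarrow> real) \<Rightarrow> real ^ 'd \<Rightarrow> real ^ 'd \<Rightarrow> complex" where
  "riesz_product a i S \<theta> \<xi> x = cis (\<xi> \<bullet> x) * (\<Prod>j\<in>S. 1 + cis (a j * x $ i + \<theta> j))"

lemma cmod_one_plus_cis: "cmod (1 + cis t) = 2 * \<bar>cos (t / 2)\<bar>"
proof -
  have "1 + cis t = 2 * cos (t / 2) * cis (t / 2)"
  proof -
    have "cis (t / 2) * cis (- (t / 2)) = 1" "cis (t / 2) * cis (t / 2) = cis t"
      by (simp_all add: cis_mult)
    moreover have "complex_of_real (2 * cos (t / 2)) = cis (t / 2) + cis (- (t / 2))"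
      by (simp add: complex_eq_iff)
    ultimately show ?thesis
      by (simp add: algebra_simps)
  qed
  then show ?thesis
    by (simp add: norm_mult)
qed

lemma cmod_riesz_product:
  "cmod (riesz_product a i S \<theta> \<xi> x) = (\<Prod>j\<in>S. 2 * \<bar>cos ((a j * x $ i + \<theta> j) / 2)\<bar>)"
  by (simp add: riesz_product_def norm_mult prod_norm[symmetric] cmod_one_plus_cis)

lemma continuous_on_riesz_product: "continuous_on A (riesz_product a i S \<theta> \<xi>)"
  unfolding riesz_product_def by (intro continuous_intros)

lemma abs_cos_half_lipschitz:
  "\<bar>\<bar>cos ((a * x + \<theta>) / 2)\<bar> - \<bar>cos ((a * y + \<theta>) / 2)\<bar>\<bar> \<le> real a * \<bar>x - y\<bar>" for x y :: real
proof -
  have "\<bar>\<bar>cos ((a * x + \<theta>) / 2)\<bar> - \<bar>cos ((a * y + \<theta>) / 2)\<bar>\<bar>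
      \<le> \<bar>(a * x + \<theta>) / 2 - (a * y + \<theta>) / 2\<bar>"
    by (rule order.trans[OF abs_triangle_ineq3 abs_cos_diff_le])
  also have "(a * x + \<theta>) / 2 - (a * y + \<theta>) / 2 = a * (x - y) / 2"
    by (simp add: field_simps)
  also have "\<bar>\<dots>\<bar> \<le> a * \<bar>x - y\<bar>"
    by (simp add: abs_mult)
  finally show ?thesis .
qed

lemma cos_half_squared_lipschitz:
  "\<bar>(cos (a * x / 2))\<^sup>2 - (cos (a * y / 2))\<^sup>2\<bar> \<le> real a * \<bar>x - y\<bar>" for x y :: real
proof -
  have sq: "(cos (t / 2))\<^sup>2 = (1 + cos t) / 2" for t :: real
    using cos_double_cos[of "t / 2"] by simp
  have "\<bar>(cos (a * x / 2))\<^sup>2 - (cos (a * y / 2))\<^sup>2\<bar> = \<bar>cos (a * x) - cos (a * y)\<bar> / 2"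
    unfolding sq by (simp flip: diff_divide_distrib)
  also have "\<dots> \<le> \<bar>a * x - a * y\<bar> / 2"
    by (intro divide_right_mono abs_cos_diff_le) auto
  also have "\<dots> \<le> a * \<bar>x - y\<bar>"
    by (simp add: abs_mult flip: right_diff_distrib)
  finally show ?thesis .
qed

text \<open>
  Missing factors are replaced by the constant \<open>2 * (1 / 2)\<close>. As \<open>1 / 2 \<le> 2 / pi\<close>, the same bound
  holds for all subproducts, and this uniformity is what the estimate of differences needs.
\<close>

lemma L1_norm_riesz_product_le:
  fixes a :: "nat \<Rightarrow> nat" and i :: "'d::finite"
  assumes a_pos: "\<And>j. j < m \<Longrightarrow> 0 < a j"
    and lac: "\<And>j. j < m \<Longrightarrow> 2 ^ (2 * j + 7) * (\<Sum>i<j. a i) \<le> a j"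
    and S: "S \<subseteq> {..<m}"
  shows "(\<integral>\<^sup>+x. ennreal (cmod (riesz_product a i S \<theta> \<xi> x)) \<partial>(torus_measure :: (real ^ 'd) measure))
    \<le> ennreal (3 / 2 * (4 / pi) ^ m)"
proof -
  define g where "g = (\<lambda>j (x::real). if j \<in> S then \<bar>cos ((a j * x + \<theta> j) / 2)\<bar> else 1 / 2 :: real)"
  interpret lacunary_factors m a g
  proof
    fix j and x y :: real assume "j < m"
    show "\<bar>g j x - g j y\<bar> \<le> a j * \<bar>x - y\<bar>"
      using abs_cos_half_lipschitz by (simp add: g_def)
    show "0 \<le> g j x \<and> g j x \<le> 1"
      by (simp add: g_def abs_cos_le_one)
    show "continuous_on UNIV (g j)"
      unfolding g_def by (cases "j \<in> S") (auto intro!: continuous_intros)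
  qed (use a_pos lac in auto)
  have "integral {c..c + 2 * pi / a j} (g j) \<le> 2 / pi * (2 * pi / a j)" if "j < m" for j c
  proof (cases "j \<in> S")
    case True
    then show ?thesis
      using integral_abs_cos_half_period[OF a_pos[OF that], of c "\<theta> j"] by (simp add: g_def)
  next
    case False
    have "1 / 2 * (2 * pi / a j) \<le> 2 / pi * (2 * pi / a j)"
      using pi_less_4 by (intro mult_right_mono) (auto simp: field_simps)
    with False show ?thesis
      by (simp add: g_def)
  qed
  then have upper: "integral {0..2 * pi} (\<lambda>t. \<Prod>j<m. g j t) \<le> 2 * pi * (3 / 2 * (2 / pi) ^ m)"
    using pi_less_4 pi_ge_two by (intro integral_prod_upper) (auto simp: field_simps)
  have "(\<Prod>j\<in>S. 2 * \<bar>cos ((a j * t + \<theta> j) / 2)\<bar>) = 2 ^ m * (\<Prod>j<m. g j t)" for t :: real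
  proof -
    have "2 ^ m * (\<Prod>j<m. g j t) = (\<Prod>j<m. 2 * g j t)"
      by (simp add: prod.distrib)
    also have "\<dots> = (\<Prod>j\<in>S. 2 * g j t)"
      using S by (intro prod.mono_neutral_right) (auto simp: g_def)
    finally show ?thesis
      by (simp add: g_def)
  qed
  then have "(\<integral>\<^sup>+x. ennreal (cmod (riesz_product a i S \<theta> \<xi> x)) \<partial>(torus_measure :: (real ^ 'd) measure))
      = (\<integral>\<^sup>+x. ennreal (2 ^ m * (\<Prod>j<m. g j (x $ i))) \<partial>(torus_measure :: (real ^ 'd) measure))"
    by (simp add: cmod_riesz_product)
  also have "\<dots> = ennreal (integral {0..2 * pi} (\<lambda>t. 2 ^ m * (\<Prod>j<m. g j t)) / (2 * pi))"
    using prod_factors_continuous[of m] prod_factors_nonneg[of m]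
    by (intro nn_integral_torus_coordinate) (auto intro!: continuous_intros)
  also have "integral {0..2 * pi} (\<lambda>t. 2 ^ m * (\<Prod>j<m. g j t)) / (2 * pi)
      = 2 ^ m * integral {0..2 * pi} (\<lambda>t. \<Prod>j<m. g j t) / (2 * pi)"
    by simp
  also have "\<dots> \<le> 2 ^ m * (2 * pi * (3 / 2 * (2 / pi) ^ m)) / (2 * pi)"
    by (intro divide_right_mono mult_left_mono upper) auto
  also have "\<dots> = 3 / 2 * (4 / pi) ^ m"
    by (simp add: power_mult_distrib[symmetric])
  finally show ?thesis
    by (simp add: ennreal_leI)
qed

text \<open>
  As \<open>p \<le> 2\<close> and \<open>\<bar>cos t\<bar> \<le> 1\<close>, the power \<open>\<bar>cos t\<bar> powr p\<close> is at least the square, whose mean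
  over a period is \<open>1 / 2\<close>.
\<close>

lemma Lp_norm_riesz_product_ge:
  fixes a :: "nat \<Rightarrow> nat" and i :: "'d::finite"
  assumes p: "1 \<le> p" "p \<le> 2"
    and a_pos: "\<And>j. j < m \<Longrightarrow> 0 < a j"
    and lac: "\<And>j. j < m \<Longrightarrow> 2 ^ (2 * j + 7) * (\<Sum>i<j. a i) \<le> a j"
  shows "(\<integral>\<^sup>+x. ennreal (cmod (riesz_product a i {..<m} (\<lambda>_. 0) \<xi> x) powr p) \<partial>(torus_measure :: (real ^ 'd) measure))
    \<ge> ennreal (1 / 2 * 2 powr (m * (p - 1)))"
proof -
  define g where "g = (\<lambda>j (x::real). (cos (real (a j) * x / 2))\<^sup>2)"
  interpret lacunary_factors m a g
  proof
    fix j and x y :: real assume "j < m"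
    show "\<bar>g j x - g j y\<bar> \<le> a j * \<bar>x - y\<bar>"
      using cos_half_squared_lipschitz by (simp add: g_def)
    show "0 \<le> g j x \<and> g j x \<le> 1"
      by (simp add: g_def abs_square_le_1)
    show "continuous_on UNIV (g j)"
      unfolding g_def by (auto intro!: continuous_intros)
  qed (use a_pos lac in auto)
  have "integral {c..c + 2 * pi / a j} (g j) \<ge> 1 / 2 * (2 * pi / a j)" if "j < m" for j c
    unfolding g_def using integral_cos_half_squared_period[OF a_pos[OF that], of c] by linarith
  then have lower: "2 * pi * (1 / 2 * (1 / 2) ^ m) \<le> integral {0..2 * pi} (\<lambda>t. \<Prod>j<m. g j t)"
    by (rule integral_prod_lower)
  define E where "E = 2 powr (m * p)"
  have pw: "E * (\<Prod>j<m. g j t) \<le> (\<Prod>j<m. 2 * \<bar>cos (a j * t / 2)\<bar>) powr p" for t :: real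
  proof -
    have factor: "g j t \<le> \<bar>cos (a j * t / 2)\<bar> powr p" for j
    proof (cases "cos (a j * t / 2) = 0")
      case False
      then have "\<bar>cos (a j * t / 2)\<bar> powr 2 \<le> \<bar>cos (a j * t / 2)\<bar> powr p"
        using p by (intro powr_mono') (auto simp: abs_cos_le_one)
      then show ?thesis
        using False by (simp add: g_def)
    qed (simp add: g_def)
    have "E * (\<Prod>j<m. g j t) = (\<Prod>j<m. 2 powr p * g j t)"
      by (simp add: E_def prod.distrib powr_powr[symmetric] powr_realpow mult.commute[of "real m"])
    also have "\<dots> \<le> (\<Prod>j<m. 2 powr p * \<bar>cos (a j * t / 2)\<bar> powr p)"
      using factor by (intro prod_mono) (auto simp: g_def)
    also have "\<dots> = (\<Prod>j<m. (2 * \<bar>cos (a j * t / 2)\<bar>) powr p)"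
      by (simp add: powr_mult)
    also have "\<dots> = (\<Prod>j<m. 2 * \<bar>cos (a j * t / 2)\<bar>) powr p"
      by (rule prod_powr_distrib[symmetric])
    finally show ?thesis .
  qed
  have "1 / 2 * 2 powr (m * (p - 1)) = E * (2 * pi * (1 / 2 * (1 / 2) ^ m)) / (2 * pi)"
    by (simp add: E_def right_diff_distrib powr_diff powr_realpow power_one_over)
  also have "\<dots> \<le> E * integral {0..2 * pi} (\<lambda>t. \<Prod>j<m. g j t) / (2 * pi)"
    by (intro divide_right_mono mult_left_mono lower) (auto simp: E_def)
  also have "\<dots> = integral {0..2 * pi} (\<lambda>t. E * (\<Prod>j<m. g j t)) / (2 * pi)"
    by simp
  finally have "ennreal (1 / 2 * 2 powr (m * (p - 1)))
      \<le> ennreal (integral {0..2 * pi} (\<lambda>t. E * (\<Prod>j<m. g j t)) / (2 * pi))"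
    by (rule ennreal_leI)
  also have "\<dots> = (\<integral>\<^sup>+x. ennreal (E * (\<Prod>j<m. g j (x $ i))) \<partial>(torus_measure :: (real ^ 'd) measure))"
    using prod_factors_continuous[of m] prod_factors_nonneg[of m]
    by (intro nn_integral_torus_coordinate[symmetric]) (auto intro!: continuous_intros simp: E_def)
  also have "\<dots> \<le> (\<integral>\<^sup>+x. ennreal (cmod (riesz_product a i {..<m} (\<lambda>_. 0) \<xi> x) powr p) \<partial>torus_measure)"
    using pw by (intro nn_integral_mono ennreal_leI) (simp add: cmod_riesz_product)
  finally show ?thesis .
qed

section \<open>Smoothness of Riesz products\<close>

lemma cmod_cis_minus_one_le: "cmod (cis t - 1) \<le> \<bar>t\<bar>"
proof -
  have "cmod (cis t - 1) = cmod (1 + cis (t + pi))"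
    by (simp add: norm_minus_commute flip: cis_mult)
  also have "\<dots> = 2 * \<bar>sin (t / 2)\<bar>"
    by (simp add: cmod_one_plus_cis add_divide_distrib cos_add)
  also have "\<dots> \<le> \<bar>t\<bar>"
    using abs_sin_x_le_abs_x[of "t / 2"] by simp
  finally show ?thesis .
qed

text \<open>
  Replace the factors one by one: the product rule for finite differences.
\<close>

lemma prod_diff_telescope:
  fixes u v :: "nat \<Rightarrow> 'a::comm_ring_1"
  assumes "finite S"
  shows "(\<Prod>j\<in>S. v j) - (\<Prod>j\<in>S. u j)
    = (\<Sum>j\<in>S. (v j - u j) * (\<Prod>l\<in>S - {j}. if l < j then u l else v l))"
  using assms
proof (induction S rule: finite_linorder_max_induct)
  case (insert k S)
  have k: "k \<notin> S"
    using insert.hyps by auto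
  have "(\<Prod>l\<in>insert k S - {j}. if l < j then u l else v l)
      = v k * (\<Prod>l\<in>S - {j}. if l < j then u l else v l)" if "j \<in> S" for j
  proof -
    have "insert k S - {j} = insert k (S - {j})" "\<not> k < j"
      using that k insert.hyps by (auto dest: less_asym)
    then show ?thesis
      using insert.hyps k by simp
  qed
  moreover have "(\<Prod>l\<in>insert k S - {k}. if l < k then u l else v l) = (\<Prod>l\<in>S. u l)"
    using insert.hyps k by (intro prod.cong) auto
  ultimately have "(\<Sum>j\<in>insert k S. (v j - u j) * (\<Prod>l\<in>insert k S - {j}. if l < j then u l else v l))
      = (v k - u k) * (\<Prod>l\<in>S. u l)
        + (\<Sum>j\<in>S. v k * ((v j - u j) * (\<Prod>l\<in>S - {j}. if l < j then u l else v l)))"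
    using insert.hyps k by (simp add: mult_ac)
  also have "\<dots> = (v k - u k) * (\<Prod>l\<in>S. u l) + v k * ((\<Prod>j\<in>S. v j) - (\<Prod>j\<in>S. u j))"
    by (simp add: insert.IH flip: sum_distrib_left)
  finally show ?case
    using insert.hyps k by (simp add: algebra_simps)
qed simp

text \<open>
  Linear combinations of Riesz products with coefficients of total modulus at most \<open>w\<close> and with
  all frequencies bounded by \<open>M\<close>. The frequency \<open>\<xi>\<close> is a real vector, since only the modulus of
  a Riesz product matters for the norms.
\<close>

inductive riesz_span ::
    "(nat \<Rightarrow> nat) \<Rightarrow> 'd::finite \<Rightarrow> nat \<Rightarrow> real \<Rightarrow> real \<Rightarrow> (real ^ 'd \<Rightarrow> complex) \<Rightarrow> bool"
  for a i m M where
  single: "S \<subseteq> {..<m} \<Longrightarrow> norm \<xi> + (\<Sum>j\<in>S. real (a j)) \<le> M \<Longrightarrow> cmod c \<le> w \<Longrightarrow>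
    riesz_span a i m M w (\<lambda>x. c * riesz_product a i S \<theta> \<xi> x)"
| add: "riesz_span a i m M w\<^sub>1 f\<^sub>1 \<Longrightarrow> riesz_span a i m M w\<^sub>2 f\<^sub>2 \<Longrightarrow>
    riesz_span a i m M (w\<^sub>1 + w\<^sub>2) (\<lambda>x. f\<^sub>1 x + f\<^sub>2 x)"

lemma riesz_span_zero: "0 \<le> M \<Longrightarrow> 0 \<le> w \<Longrightarrow> riesz_span a i m M w (\<lambda>x. 0)"
  using riesz_span.single[of "{}" m 0 a M 0 w i] by simp

lemma riesz_span_mono:
  assumes "riesz_span a i m M w f" "w \<le> w'" "0 \<le> M"
  shows "riesz_span a i m M w' f"
  using riesz_span.add[OF assms(1) riesz_span_zero[of M "w' - w" a i m]] assms by simp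

lemma riesz_span_sum:
  assumes "finite J" "0 \<le> M" "\<And>j. j \<in> J \<Longrightarrow> riesz_span a i m M (w j) (f j)"
  shows "riesz_span a i m M (\<Sum>j\<in>J. w j) (\<lambda>x. \<Sum>j\<in>J. f j x)"
  using assms by (induction J rule: finite_induct) (auto intro: riesz_span_zero riesz_span.add)

lemma riesz_span_nonneg: "riesz_span a i m M w f \<Longrightarrow> 0 \<le> w"
  by (induction rule: riesz_span.induct) (auto intro: order.trans[OF norm_ge_zero])

lemma riesz_span_continuous: "riesz_span a i m M w f \<Longrightarrow> continuous_on UNIV f"
  by (induction rule: riesz_span.induct) (auto intro!: continuous_intros continuous_on_riesz_product)

lemma riesz_span_uminus: "riesz_span a i m M w f \<Longrightarrow> riesz_span a i m M w (\<lambda>x. - f x)"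
proof (induction rule: riesz_span.induct)
  case (single S \<xi> c w \<theta>)
  then show ?case
    using riesz_span.single[of S m \<xi> a M "- c" w i \<theta>] by simp
next
  case (add w1 f1 w2 f2)
  then show ?case
    using riesz_span.add[OF add.IH] by (simp add: add.commute)
qed

lemma riesz_product_shift:
  "riesz_product a i S \<theta> \<xi> (x + h) = cis (\<xi> \<bullet> h) * riesz_product a i S (\<lambda>j. \<theta> j + a j * h $ i) \<xi> x"
  by (simp add: riesz_product_def inner_add_right algebra_simps flip: cis_mult)

lemma riesz_span_shift: "riesz_span a i m M w f \<Longrightarrow> riesz_span a i m M w (\<lambda>x. f (x + h))"
proof (induction rule: riesz_span.induct)
  case (single S \<xi> c w \<theta>)
  then show ?case
    using riesz_span.single[of S m \<xi> a M "c * cis (\<xi> \<bullet> h)" w i "\<lambda>j. \<theta> j + a j * h $ i"]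
    by (simp add: riesz_product_shift norm_mult mult.assoc)
qed (auto intro: riesz_span.add)

text \<open>
  For large steps the trivial bound is better than \<open>riesz_span_fdiff\<close>.
\<close>

lemma riesz_span_fdiff_double:
  assumes "riesz_span a i m M w f"
  shows "riesz_span a i m M (2 * w) (fdiff h f)"
  using riesz_span.add[OF riesz_span_shift[OF assms, of h] riesz_span_uminus[OF assms]]
  by (simp add: fdiff_def)

text \<open>
  The product rule: either the exponential or one factor with index \<open>j\<close> changes. In the second case
  the factor disappears and its frequency moves into the exponential, so that
  \<open>norm \<xi> + (\<Sum>j\<in>S. a j)\<close> does not increase.
\<close>

lemma riesz_product_difference:
  assumes "finite S"
  shows "riesz_product a i S \<theta> \<xi> (x + h) - riesz_product a i S \<theta> \<xi> x
    = (cis (\<xi> \<bullet> h) - 1) * riesz_product a i S (\<lambda>j. \<theta> j + a j * h $ i) \<xi> x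
      + (\<Sum>j\<in>S. (cis (a j * h $ i) - 1) * cis (\<theta> j) *
          riesz_product a i (S - {j}) (\<lambda>l. if l < j then \<theta> l else \<theta> l + a l * h $ i)
            (\<xi> + axis i (real (a j))) x)"
proof -
  define u where "u = (\<lambda>j. 1 + cis (a j * x $ i + \<theta> j))"
  define v where "v = (\<lambda>j. 1 + cis (a j * x $ i + (\<theta> j + a j * h $ i)))"
  have summand: "(cis (a j * h $ i) - 1) * cis (\<theta> j) *
          riesz_product a i (S - {j}) (\<lambda>l. if l < j then \<theta> l else \<theta> l + a l * h $ i)
            (\<xi> + axis i (real (a j))) x
      = cis (\<xi> \<bullet> x) * ((v j - u j) * (\<Prod>l\<in>S - {j}. if l < j then u l else v l))" for j
  proof -
    have "(\<Prod>l\<in>S - {j}. 1 + cis (a l * x $ i + (if l < j then \<theta> l else \<theta> l + a l * h $ i)))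
        = (\<Prod>l\<in>S - {j}. if l < j then u l else v l)"
      by (intro prod.cong) (auto simp: u_def v_def)
    moreover have "v j - u j = (cis (a j * h $ i) - 1) * cis (\<theta> j) * cis (a j * x $ i)"
      by (simp add: u_def v_def algebra_simps flip: cis_mult)
    moreover have "cis ((\<xi> + axis i (real (a j))) \<bullet> x) = cis (\<xi> \<bullet> x) * cis (a j * x $ i)"
      by (simp add: inner_add_left inner_axis' cis_mult)
    ultimately show ?thesis
      by (simp add: riesz_product_def mult_ac)
  qed
  have "riesz_product a i S \<theta> \<xi> (x + h) - riesz_product a i S \<theta> \<xi> x
      = (cis (\<xi> \<bullet> h) - 1) * (cis (\<xi> \<bullet> x) * (\<Prod>j\<in>S. v j))
        + cis (\<xi> \<bullet> x) * ((\<Prod>j\<in>S. v j) - (\<Prod>j\<in>S. u j))"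
    by (simp add: riesz_product_shift) (simp add: riesz_product_def u_def v_def algebra_simps)
  also have "\<dots> = (cis (\<xi> \<bullet> h) - 1) * (cis (\<xi> \<bullet> x) * (\<Prod>j\<in>S. v j))
        + (\<Sum>j\<in>S. cis (\<xi> \<bullet> x) * ((v j - u j) * (\<Prod>l\<in>S - {j}. if l < j then u l else v l)))"
    by (simp only: prod_diff_telescope[OF assms] sum_distrib_left)
  finally show ?thesis
    by (simp only: summand) (simp add: riesz_product_def v_def)
qed

text \<open>
  A Bernstein inequality. The coefficients in \<open>riesz_product_difference\<close> are bounded by the
  frequencies times \<open>norm h\<close>, and these frequencies have sum at most \<open>M\<close>.
\<close>

lemma riesz_span_fdiff:
  assumes "riesz_span a i m M w f" and M: "0 \<le> M"
  shows "riesz_span a i m M (M * norm h * w) (fdiff h f)"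
  using assms(1)
proof (induction rule: riesz_span.induct)
  case (single S \<xi> c w \<theta>)
  have fin: "finite S"
    using single finite_subset by blast
  define w1 where "w1 = cmod c * (norm \<xi> * norm h)"
  define w2 where "w2 = (\<lambda>j. cmod c * (a j * norm h))"
  have "riesz_span a i m M w1
      (\<lambda>x. (c * (cis (\<xi> \<bullet> h) - 1)) * riesz_product a i S (\<lambda>j. \<theta> j + a j * h $ i) \<xi> x)"
  proof (rule riesz_span.single)
    have "cmod (cis (\<xi> \<bullet> h) - 1) \<le> norm \<xi> * norm h"
      by (rule order.trans[OF cmod_cis_minus_one_le Cauchy_Schwarz_ineq2])
    then show "cmod (c * (cis (\<xi> \<bullet> h) - 1)) \<le> w1"
      by (simp add: norm_mult w1_def mult_left_mono)
  qed (use single in auto)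
  moreover have "riesz_span a i m M (\<Sum>j\<in>S. w2 j)
      (\<lambda>x. \<Sum>j\<in>S. (c * ((cis (a j * h $ i) - 1) * cis (\<theta> j))) *
          riesz_product a i (S - {j}) (\<lambda>l. if l < j then \<theta> l else \<theta> l + a l * h $ i)
            (\<xi> + axis i (real (a j))) x)"
  proof (intro riesz_span_sum riesz_span.single fin M)
    fix j assume j: "j \<in> S"
    have "norm (\<xi> + axis i (real (a j))) \<le> norm \<xi> + a j"
      using norm_triangle_ineq[of \<xi> "axis i (real (a j))"]
      by (simp add: norm_eq_sqrt_inner[of "axis i _"] inner_axis_axis)
    moreover have "(\<Sum>l\<in>S. real (a l)) = a j + (\<Sum>l\<in>S - {j}. real (a l))"
      by (rule sum.remove[OF fin j])
    ultimately show "norm (\<xi> + axis i (real (a j))) + (\<Sum>l\<in>S - {j}. real (a l)) \<le> M"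
      using single by linarith
    have "cmod (cis (a j * h $ i) - 1) \<le> \<bar>a j * h $ i\<bar>"
      by (rule cmod_cis_minus_one_le)
    also have "\<dots> \<le> a j * norm h"
      by (simp add: abs_mult mult_left_mono component_le_norm_cart)
    finally show "cmod (c * ((cis (a j * h $ i) - 1) * cis (\<theta> j))) \<le> w2 j"
      by (simp add: norm_mult w2_def mult_left_mono)
  qed (use single in auto)
  moreover have "fdiff h (\<lambda>x. c * riesz_product a i S \<theta> \<xi> x) =
      (\<lambda>x. (c * (cis (\<xi> \<bullet> h) - 1)) * riesz_product a i S (\<lambda>j. \<theta> j + a j * h $ i) \<xi> x
        + (\<Sum>j\<in>S. (c * ((cis (a j * h $ i) - 1) * cis (\<theta> j))) *
          riesz_product a i (S - {j}) (\<lambda>l. if l < j then \<theta> l else \<theta> l + a l * h $ i)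
            (\<xi> + axis i (real (a j))) x))"
    by (rule ext) (simp only: fdiff_def right_diff_distrib[symmetric] riesz_product_difference[OF fin]
        distrib_left sum_distrib_left mult.assoc)
  ultimately have "riesz_span a i m M (w1 + (\<Sum>j\<in>S. w2 j)) (fdiff h (\<lambda>x. c * riesz_product a i S \<theta> \<xi> x))"
    by (simp only: riesz_span.add)
  moreover have "w1 + (\<Sum>j\<in>S. w2 j) \<le> M * norm h * w"
  proof -
    have "w1 + (\<Sum>j\<in>S. w2 j) = (norm \<xi> + (\<Sum>j\<in>S. real (a j))) * norm h * cmod c"
      by (simp add: w1_def w2_def algebra_simps sum_distrib_left sum_distrib_right)
    also have "\<dots> \<le> M * norm h * w"
      using single M by (intro mult_mono mult_nonneg_nonneg) auto
    finally show ?thesis .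
  qed
  ultimately show ?case
    using M by (rule riesz_span_mono)
next
  case (add w1 f1 w2 f2)
  have "fdiff h (\<lambda>x. f1 x + f2 x) = (\<lambda>x. fdiff h f1 x + fdiff h f2 x)"
    by (simp add: fdiff_def fun_eq_iff)
  then show ?case
    using riesz_span.add[OF add.IH] by (simp add: distrib_left)
qed

lemma riesz_span_iterated_fdiff:
  assumes "riesz_span a i m M w f" and M: "0 \<le> M"
  shows "riesz_span a i m M (2 ^ k * w) ((fdiff h ^^ k) f)"
    and "riesz_span a i m M ((M * norm h) ^ k * w) ((fdiff h ^^ k) f)"
proof -
  show "riesz_span a i m M (2 ^ k * w) ((fdiff h ^^ k) f)"
  proof (induction k)
    case (Suc k)
    from riesz_span_fdiff_double[OF this, of h] show ?case
      by (simp add: mult.assoc)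
  qed (use assms in simp)
  show "riesz_span a i m M ((M * norm h) ^ k * w) ((fdiff h ^^ k) f)"
  proof (induction k)
    case (Suc k)
    from riesz_span_fdiff[OF this M, of h] show ?case
      by (simp add: mult.assoc)
  qed (use assms in simp)
qed

lemma riesz_span_L1_norm_le:
  assumes lac: "\<And>j. j < m \<Longrightarrow> 0 < a j" "\<And>j. j < m \<Longrightarrow> 2 ^ (2 * j + 7) * (\<Sum>i<j. a i) \<le> a j"
    and f: "riesz_span a i m M w f"
  shows "torus_Lp_norm 1 f \<le> ennreal (w * (3 / 2 * (4 / pi) ^ m))"
  using f
proof (induction rule: riesz_span.induct)
  case (single S \<xi> c w \<theta>)
  have meas: "(\<lambda>x. ennreal (cmod (riesz_product a i S \<theta> \<xi> x))) \<in> borel_measurable torus_measure"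
    by (intro borel_measurable_torus measurable_compose[OF _ measurable_ennreal] borel_measurable_continuous_onI
        continuous_on_norm continuous_on_riesz_product)
  have "torus_Lp_norm 1 (\<lambda>x. c * riesz_product a i S \<theta> \<xi> x)
      = ennreal (cmod c) * (\<integral>\<^sup>+x. ennreal (cmod (riesz_product a i S \<theta> \<xi> x)) \<partial>torus_measure)"
    by (simp add: torus_Lp_norm_1 norm_mult ennreal_mult nn_integral_cmult[OF meas])
  also have "\<dots> \<le> ennreal w * ennreal (3 / 2 * (4 / pi) ^ m)"
    using single by (intro mult_mono L1_norm_riesz_product_le lac ennreal_leI) auto
  also have "\<dots> = ennreal (w * (3 / 2 * (4 / pi) ^ m))"
    by (rule ennreal_mult''[symmetric]) simp
  finally show ?case .
next
  case (add w1 f1 w2 f2)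
  have meas: "(\<lambda>x. ennreal (cmod (f x))) \<in> borel_measurable torus_measure"
    if "riesz_span a i m M w f" for f w
    using riesz_span_continuous[OF that]
    by (intro borel_measurable_torus measurable_compose[OF _ measurable_ennreal] borel_measurable_continuous_onI
        continuous_on_norm)
  have "torus_Lp_norm 1 (\<lambda>x. f1 x + f2 x)
      \<le> (\<integral>\<^sup>+x. ennreal (cmod (f1 x)) + ennreal (cmod (f2 x)) \<partial>torus_measure)"
    unfolding torus_Lp_norm_1
    by (intro nn_integral_mono) (simp add: norm_triangle_ineq flip: ennreal_plus)
  also have "\<dots> = torus_Lp_norm 1 f1 + torus_Lp_norm 1 f2"
    unfolding torus_Lp_norm_1
    by (rule nn_integral_add[OF meas[OF add.hyps(1)] meas[OF add.hyps(2)]])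
  also have "\<dots> \<le> ennreal (w1 * (3 / 2 * (4 / pi) ^ m)) + ennreal (w2 * (3 / 2 * (4 / pi) ^ m))"
    by (intro add_mono add.IH)
  also have "\<dots> = ennreal ((w1 + w2) * (3 / 2 * (4 / pi) ^ m))"
    using add.hyps[THEN riesz_span_nonneg] by (simp add: distrib_right flip: ennreal_plus)
  finally show ?case .
qed

text \<open>
  The difference of order \<open>k\<close> gains the factor \<open>min (2 ^ k) ((M * t) ^ k)\<close>. Multiplied by
  \<open>t powr (- s)\<close>, it is at most \<open>2 ^ k * M powr s\<close>: use the second bound for \<open>t \<le> 1 / M\<close>, where
  \<open>k > s\<close> enters, and the first one for larger \<open>t\<close>.
\<close>

lemma riesz_span_besov_norm_le:
  fixes f :: "real ^ 'd::finite \<Rightarrow> complex"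
  assumes lac: "\<And>j. j < m \<Longrightarrow> 0 < a j" "\<And>j. j < m \<Longrightarrow> 2 ^ (2 * j + 7) * (\<Sum>i<j. a i) \<le> a j"
    and f: "riesz_span a i m M w f" and M: "0 < M" and s: "0 < s" "s < real k"
  shows "besov_norm k s f \<le> ennreal (w * (3 / 2 * (4 / pi) ^ m) * (1 + 2 ^ k * M powr s))"
proof -
  define B where "B = w * (3 / 2 * (4 / pi) ^ m)"
  have B: "0 \<le> B"
    using riesz_span_nonneg[OF f] by (simp add: B_def)
  have "besov_seminorm k s f \<le> ennreal (B * (2 ^ k * M powr s))"
    unfolding besov_seminorm_def
  proof (rule SUP_least)
    fix t :: real assume "t \<in> {0<..}"
    then have t: "0 < t" by simp
    define W where "W = min (2 ^ k) ((M * t) ^ k)"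
    have W: "t powr (- s) * W \<le> 2 ^ k * M powr s"
    proof (cases "M * t \<le> 1")
      case True
      have "t powr (- s) * (M * t) ^ k = M powr s * (M * t) powr (k - s)"
        using M t by (simp add: powr_diff powr_mult powr_minus powr_realpow field_simps)
      also have "\<dots> \<le> M powr s * 1"
        using True M t s by (intro mult_left_mono powr_le1) auto
      also have "\<dots> \<le> 2 ^ k * M powr s"
        using mult_right_mono[of 1 "2 ^ k" "M powr s"] by simp
      finally show ?thesis
        using t by (smt (verit) W_def min_le_iff_disj mult_left_mono powr_ge_zero)
    next
      case False
      then have "t powr (- s) \<le> (1 / M) powr (- s)"
        using M t s by (intro powr_mono2') (auto simp: field_simps)
      also have "\<dots> = M powr s"
        using M by (simp add: powr_divide powr_minus_divide)
      finally have "t powr (- s) * W \<le> M powr s * 2 ^ k"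
        by (intro mult_mono) (auto simp: W_def M t less_imp_le)
      then show ?thesis
        by (simp add: mult.commute)
    qed
    have "modulus_of_smoothness_L1 k f t \<le> ennreal (B * W)"
      unfolding modulus_of_smoothness_L1_def
    proof (rule SUP_least)
      fix h :: "real ^ 'd" assume "h \<in> {h. norm h \<le> t}"
      then have h: "(M * norm h) ^ k \<le> (M * t) ^ k"
        using M by (intro power_mono mult_left_mono) auto
      have "torus_Lp_norm 1 ((fdiff h ^^ k) f) \<le> ennreal (B * 2 ^ k)"
        using riesz_span_L1_norm_le[OF lac riesz_span_iterated_fdiff(1)[OF f, where k = k and h = h]] M
        by (simp add: B_def mult_ac)
      moreover have "torus_Lp_norm 1 ((fdiff h ^^ k) f) \<le> ennreal (B * (M * norm h) ^ k)"
        using riesz_span_L1_norm_le[OF lac riesz_span_iterated_fdiff(2)[OF f, where k = k and h = h]] M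
        by (simp add: B_def mult_ac)
      then have "torus_Lp_norm 1 ((fdiff h ^^ k) f) \<le> ennreal (B * (M * t) ^ k)"
        using h B by (elim order.trans) (intro ennreal_leI mult_left_mono)
      ultimately show "torus_Lp_norm 1 ((fdiff h ^^ k) f) \<le> ennreal (B * W)"
        by (simp add: W_def min_def)
    qed
    then have "ennreal (t powr (- s)) * modulus_of_smoothness_L1 k f t
        \<le> ennreal (t powr (- s)) * ennreal (B * W)"
      by (intro mult_left_mono) auto
    also have "\<dots> = ennreal (B * (t powr (- s) * W))"
      by (simp add: mult_ac flip: ennreal_mult'')
    also have "\<dots> \<le> ennreal (B * (2 ^ k * M powr s))"
      using W B by (intro ennreal_leI mult_left_mono)
    finally show "ennreal (t powr (- s)) * modulus_of_smoothness_L1 k f t \<le> \<dots>" .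
  qed
  moreover have "torus_Lp_norm 1 f \<le> ennreal B"
    using riesz_span_L1_norm_le[OF lac f] by (simp add: B_def)
  ultimately have "besov_norm k s f \<le> ennreal B + ennreal (B * (2 ^ k * M powr s))"
    unfolding besov_norm_def by (rule add_mono[rotated])
  also have "\<dots> = ennreal (B * (1 + 2 ^ k * M powr s))"
    using B by (simp add: distrib_left flip: ennreal_plus)
  finally show ?thesis
    by (simp add: B_def)
qed

section \<open>Fooling functions\<close>

text \<open>
  Expanding the product, the frequencies are exactly the points of a cube.
\<close>

lemma fourier_coeff_riesz_product_eq_0:
  fixes \<xi> \<eta> :: "int ^ 'd::finite" and a :: "nat \<Rightarrow> nat"
  assumes avoid: "\<And>T. T \<subseteq> {..<m} \<Longrightarrow> \<xi> + axis i (\<Sum>j\<in>T. int (a j)) \<noteq> \<eta>"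
  shows "fourier_coeff (\<lambda>x. c * riesz_product a i {..<m} (\<lambda>_. 0) (\<chi> j. real_of_int (\<xi> $ j)) x) \<eta> = 0"
proof -
  define \<omega> where "\<omega> = (\<lambda>T. \<xi> + axis i (\<Sum>j\<in>T. int (a j)) - \<eta>)"
  define e :: "int ^ 'd \<Rightarrow> real ^ 'd \<Rightarrow> complex"
    where "e = (\<lambda>\<omega> x. cis (\<Sum>j\<in>UNIV. real_of_int (\<omega> $ j) * x $ j))"
  have axis_sum: "(\<Sum>j\<in>UNIV. real_of_int (axis i t $ j) * x $ j) = t * x $ i" for t and x :: "real ^ 'd"
    by (simp add: axis_def if_distrib if_distribR cong: if_cong)
  have e_\<omega>: "e (\<omega> T) x = cis ((\<chi> j. real_of_int (\<xi> $ j)) \<bullet> x) * (\<Prod>j\<in>T. cis (a j * x $ i))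
      * exp (- \<i> * complex_of_real (\<Sum>j\<in>UNIV. real_of_int (\<eta> $ j) * x $ j))" if "finite T" for T x
  proof -
    have "(\<Prod>j\<in>T. cis (a j * x $ i)) = cis (\<Sum>j\<in>T. a j * x $ i)"
      using that by (induction T rule: finite_induct) (simp_all flip: cis_mult)
    also have "(\<Sum>j\<in>T. a j * x $ i) = (\<Sum>j\<in>T. int (a j)) * x $ i"
      by (simp add: sum_distrib_right)
    finally have 1: "(\<Prod>j\<in>T. cis (a j * x $ i)) = cis ((\<Sum>j\<in>T. int (a j)) * x $ i)" .
    have 2: "exp (- \<i> * complex_of_real t) = cis (- t)" for t
      by (simp add: cis_conv_exp)
    have "(\<Sum>j\<in>UNIV. real_of_int (\<omega> T $ j) * x $ j)
        = (\<chi> j. real_of_int (\<xi> $ j)) \<bullet> x + (\<Sum>j\<in>T. int (a j)) * x $ i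
          + - (\<Sum>j\<in>UNIV. real_of_int (\<eta> $ j) * x $ j)"
      unfolding axis_sum[symmetric]
      by (simp add: \<omega>_def inner_vec_def algebra_simps sum.distrib sum_subtractf)
    then show ?thesis
      unfolding 1 2 e_def by (simp only: cis_mult)
  qed
  have "c * riesz_product a i {..<m} (\<lambda>_. 0) (\<chi> j. real_of_int (\<xi> $ j)) x
        * exp (- \<i> * complex_of_real (\<Sum>j\<in>UNIV. real_of_int (\<eta> $ j) * x $ j))
      = (\<Sum>T\<in>Pow {..<m}. c * e (\<omega> T) x)" for x
  proof -
    have "(\<Prod>j<m. 1 + cis (a j * x $ i + 0)) = (\<Sum>T\<in>Pow {..<m}. \<Prod>j\<in>T. cis (a j * x $ i))"
      using prod_add[of "{..<m}" "\<lambda>j. cis (a j * x $ i)" "\<lambda>_. 1"] by (simp add: add.commute)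
    moreover have "finite T" if "T \<in> Pow {..<m}" for T
      using that finite_subset by blast
    ultimately show ?thesis
      by (simp add: riesz_product_def e_\<omega> sum_distrib_left sum_distrib_right mult_ac)
  qed
  moreover have "integrable torus_measure (e (\<omega> T))" for T
    by (intro integrable_torus_unimodular) (auto simp: e_def intro!: continuous_intros)
  moreover have "(\<integral>x. e (\<omega> T) x \<partial>torus_measure) = 0" if "T \<subseteq> {..<m}" for T
    unfolding e_def using avoid[OF that] by (intro integral_torus_character) (simp add: \<omega>_def)
  ultimately show ?thesis
    by (simp add: fourier_coeff_def)
qed

lemma torus_function_riesz_product:
  fixes \<xi> :: "int ^ 'd::finite" and a :: "nat \<Rightarrow> nat"
  shows "torus_function (\<lambda>x. c * riesz_product a i S \<theta> (\<chi> j. real_of_int (\<xi> $ j)) x)"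
  unfolding torus_function_def
proof (intro conjI allI)
  have "(\<lambda>x. c * riesz_product a i S \<theta> (\<chi> j. real_of_int (\<xi> $ j)) x) \<in> borel_measurable borel"
    by (intro borel_measurable_continuous_onI continuous_intros continuous_on_riesz_product)
  then show "(\<lambda>x. c * riesz_product a i S \<theta> (\<chi> j. real_of_int (\<xi> $ j)) x) \<in> borel_measurable lebesgue"
    by (simp add: measurable_completion)
next
  fix x :: "real ^ 'd" and j
  have period: "cis (t + real_of_int l * (2 * pi)) = cis t" for t l
    using cis_multiple_2pi[of "real_of_int l"] by (simp add: mult_ac flip: cis_mult)
  have "cis ((\<chi> j. real_of_int (\<xi> $ j)) \<bullet> (2 * pi) *\<^sub>R axis j 1) = 1"
    using period[of 0 "\<xi> $ j"] by (simp add: inner_axis mult_ac)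
  moreover have "cis (a l * x $ i + (\<theta> l + a l * ((2 * pi) *\<^sub>R axis j 1 :: real ^ 'd) $ i))
      = cis (a l * x $ i + \<theta> l)" for l
    using period[of "a l * x $ i + \<theta> l" "int (a l)"]
    by (cases "i = j") (simp_all add: axis_def add_ac)
  ultimately show "c * riesz_product a i S \<theta> (\<chi> j. real_of_int (\<xi> $ j)) (x + (2 * pi) *\<^sub>R axis j 1)
      = c * riesz_product a i S \<theta> (\<chi> j. real_of_int (\<xi> $ j)) x"
    unfolding riesz_product_shift by (simp add: riesz_product_def)
qed

text \<open>
  The allowed points of a suitable line contain a lacunary cube, and the Riesz product with these
  frequencies, scaled to have Besov norm at most \<open>1\<close>, has the required \<open>L\<^sub>p\<close> norm.
\<close>

lemma fooling_function:
  fixes \<Xi> :: "(int ^ 'd::finite) set" and N m k :: nat and s p :: real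
  assumes s: "0 < s" "s < real k" and p: "1 \<le> p" "p \<le> 2"
    and fin: "finite \<Xi>" and card: "2 * card \<Xi> \<le> N ^ CARD('d)" and N: "0 < N"
    and m: "m = 0 \<or> (2 ^ 2 ^ m) ^ 21 \<le> N"
  obtains f :: "real ^ 'd \<Rightarrow> complex"
  where "f \<in> besov_ball k s" and "\<And>\<eta>. \<eta> \<in> \<Xi> \<Longrightarrow> fourier_coeff f \<eta> = 0"
    and "ennreal ((pi / 2 powr (1 + 1 / p)) ^ m / (3 * (1 + 2 ^ k * ((CARD('d) + 1) * N) powr s)))
           \<le> torus_Lp_norm p f"
proof -
  define i :: 'd where "i = undefined"
  obtain \<zeta> :: "int ^ 'd" where \<zeta>: "\<zeta> $ i = 0" "\<And>j. 0 \<le> \<zeta> $ j" "\<And>j. \<zeta> $ j < N"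
    and dense: "N \<le> 2 * card {t \<in> {0..<int N}. \<zeta> + axis i t \<notin> \<Xi>}"
    using line_with_few_points[OF fin card N, of i] by blast
  define A where "A = {t \<in> {0..<int N}. \<zeta> + axis i t \<notin> \<Xi>}"
  have A_sub: "A \<subseteq> {0..<int N}"
    by (auto simp: A_def)
  have A_dense: "int N \<le> 2 * int (card A)"
    using dense by (simp add: A_def)
  have m': "m = 0 \<or> (2 ^ 2 ^ m) ^ 21 \<le> int N"
    using m by (metis of_nat_le_iff of_nat_numeral of_nat_power)
  obtain a x where a_pos: "\<And>j. j < m \<Longrightarrow> 0 < a j"
    and lac: "\<And>j. j < m \<Longrightarrow> 2 ^ (2 * j + 7) * (\<Sum>i<j. a i) \<le> a j"
    and cube: "\<And>T. T \<subseteq> {..<m} \<Longrightarrow> x + (\<Sum>j\<in>T. a j) \<in> A"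
    using lacunary_cube[OF A_sub _ A_dense m'] N by (metis of_nat_0_less_iff)
  define b where "b = (\<lambda>j. nat (a j))"
  have b: "int (b j) = a j" if "j < m" for j
    using a_pos[OF that] by (simp add: b_def)
  have b_sum: "(\<Sum>j\<in>T. int (b j)) = (\<Sum>j\<in>T. a j)" if "T \<subseteq> {..<m}" for T
    using that by (intro sum.cong) (auto simp: b)
  have b_pos: "0 < b j" if "j < m" for j
    using a_pos[OF that] by (simp add: b_def)
  have b_lac: "2 ^ (2 * j + 7) * (\<Sum>i<j. b i) \<le> b j" if "j < m" for j
  proof -
    have "int (2 ^ (2 * j + 7) * (\<Sum>i<j. b i)) \<le> int (b j)"
      using lac[OF that] b_sum[of "{..<j}"] b[OF that] that by simp
    then show ?thesis
      by (simp only: of_nat_le_iff)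
  qed
  define \<xi> where "\<xi> = \<zeta> + axis i x"
  define M where "M = real ((CARD('d) + 1) * N)"
  have M: "0 < M"
    using N by (simp add: M_def add_pos_nonneg)
  have x: "0 \<le> x" "x < N" and x_sum: "x + (\<Sum>j<m. a j) < N"
    using cube[of "{}"] cube[of "{..<m}"] by (auto simp: A_def)
  have freq: "norm (\<chi> j. real_of_int (\<xi> $ j)) + (\<Sum>j<m. real (b j)) \<le> M"
  proof -
    have "\<bar>real_of_int (\<xi> $ j)\<bar> \<le> N" for j
      using \<zeta>(1) \<zeta>(2,3)[of j] x by (cases "j = i") (simp_all add: \<xi>_def axis_def)
    then have "(\<Sum>j\<in>UNIV. \<bar>(\<chi> j. real_of_int (\<xi> $ j)) $ j\<bar>) \<le> (\<Sum>j\<in>(UNIV :: 'd set). real N)"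
      by (intro sum_mono) simp
    then have "norm (\<chi> j. real_of_int (\<xi> $ j)) \<le> CARD('d) * real N"
      using norm_le_l1_cart[of "\<chi> j. real_of_int (\<xi> $ j)"] by simp
    moreover have "(\<Sum>j<m. real (b j)) = real_of_int (\<Sum>j<m. a j)"
      by (simp flip: b_sum[OF order.refl])
    moreover have "real_of_int (\<Sum>j<m. a j) \<le> real_of_int (int N)"
      using x x_sum by (subst of_int_le_iff) linarith
    moreover have "M = CARD('d) * real N + real_of_int (int N)"
      by (simp add: M_def algebra_simps)
    ultimately show ?thesis
      by linarith
  qed
  define B where "B = 3 / 2 * (4 / pi) ^ m"
  define w where "w = 1 / (B * (1 + 2 ^ k * M powr s))"
  have pos: "0 < B" "0 < 1 + 2 ^ k * M powr s"
    by (simp_all add: B_def add_pos_nonneg)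
  then have w: "0 < w"
    by (simp add: w_def)
  define f where "f = (\<lambda>x. complex_of_real w * riesz_product b i {..<m} (\<lambda>_. 0) (\<chi> j. real_of_int (\<xi> $ j)) x)"
  have "riesz_span b i m M w f"
    unfolding f_def using freq w by (intro riesz_span.single) auto
  from riesz_span_besov_norm_le[OF b_pos b_lac this M s]
  have "besov_norm k s f \<le> ennreal (w * B * (1 + 2 ^ k * M powr s))"
    by (simp add: B_def)
  also have "w * B * (1 + 2 ^ k * M powr s) = 1"
    using pos by (simp add: w_def)
  finally have "f \<in> besov_ball k s"
    using torus_function_riesz_product[of w b i "{..<m}" "\<lambda>_. 0" \<xi>] by (simp add: besov_ball_def f_def)
  moreover have "fourier_coeff f \<eta> = 0" if "\<eta> \<in> \<Xi>" for \<eta>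
    unfolding f_def
  proof (rule fourier_coeff_riesz_product_eq_0)
    fix T assume T: "T \<subseteq> {..<m}"
    have "\<xi> + axis i (\<Sum>j\<in>T. int (b j)) = \<zeta> + axis i (x + (\<Sum>j\<in>T. a j))"
      unfolding b_sum[OF T] by (simp add: \<xi>_def vec_eq_iff axis_def)
    then show "\<xi> + axis i (\<Sum>j\<in>T. int (b j)) \<noteq> \<eta>"
      using cube[OF T] that by (auto simp: A_def)
  qed
  moreover have "ennreal ((pi / 2 powr (1 + 1 / p)) ^ m / (3 * (1 + 2 ^ k * M powr s))) \<le> torus_Lp_norm p f"
  proof (rule torus_Lp_norm_ge)
    define r where "r = w / 2 * 2 powr (m * (1 - 1 / p))"
    have base: "pi / 2 powr (1 + 1 / p) = pi / 4 * 2 powr (1 - 1 / p)"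
      by (simp add: powr_add powr_diff)
    have "2 powr (m * (1 - 1 / p)) = (2 powr (1 - 1 / p)) ^ m"
      by (subst mult.commute, subst powr_powr[symmetric], subst powr_realpow) auto
    then have "(pi / 2 powr (1 + 1 / p)) ^ m = (pi / 4) ^ m * 2 powr (m * (1 - 1 / p))"
      unfolding base by (simp only: power_mult_distrib)
    then have r: "(pi / 2 powr (1 + 1 / p)) ^ m / (3 * (1 + 2 ^ k * M powr s)) = r"
      by (simp add: r_def w_def B_def power_divide)
    show "0 \<le> (pi / 2 powr (1 + 1 / p)) ^ m / (3 * (1 + 2 ^ k * M powr s))"
      unfolding r using w by (simp add: r_def)
    have meas: "(\<lambda>x. ennreal (cmod (riesz_product b i {..<m} (\<lambda>_. 0) \<xi>' x) powr p))
        \<in> borel_measurable torus_measure" for \<xi>'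
    proof -
      note [measurable] = borel_measurable_continuous_onI[OF continuous_on_riesz_product]
      show ?thesis
        by (intro borel_measurable_torus) measurable
    qed
    have "r powr p = w powr p * (1 / 2) powr p * 2 powr (m * (p - 1))"
    proof -
      have "m * (1 - 1 / p) * p = m * (p - 1)"
        using p by (simp add: left_diff_distrib right_diff_distrib)
      moreover have "r = w * (1 / 2) * 2 powr (m * (1 - 1 / p))"
        by (simp add: r_def)
      ultimately show ?thesis
        using w by (simp only: powr_mult powr_powr)
    qed
    also have "\<dots> \<le> w powr p * (1 / 2) powr 1 * 2 powr (m * (p - 1))"
      using p by (intro mult_right_mono mult_left_mono powr_mono') auto
    finally have "ennreal (r powr p) \<le> ennreal (w powr p) * ennreal (1 / 2 * 2 powr (m * (p - 1)))"
      by (simp add: ennreal_leI flip: ennreal_mult)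
    also have "\<dots> \<le> ennreal (w powr p) *
        (\<integral>\<^sup>+x. ennreal (cmod (riesz_product b i {..<m} (\<lambda>_. 0) (\<chi> j. real_of_int (\<xi> $ j)) x) powr p) \<partial>torus_measure)"
      by (intro mult_left_mono Lp_norm_riesz_product_ge p b_pos b_lac) auto
    also have "\<dots> = (\<integral>\<^sup>+x. ennreal (cmod (f x) powr p) \<partial>torus_measure)"
      using w by (simp add: f_def norm_mult powr_mult ennreal_mult nn_integral_cmult[OF meas])
    finally show "ennreal (((pi / 2 powr (1 + 1 / p)) ^ m / (3 * (1 + 2 ^ k * M powr s))) powr p) \<le> \<dots>"
      unfolding r .
  qed (use p in auto)
  ultimately show thesis
    using that[of f] unfolding M_def by blast
qed

section \<open>The choice of the dimension of the cube\<close>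

text \<open>
  For \<open>L = log 2 N\<close> the first property is the condition under which \<open>lacunary_cube\<close> provides
  a cube of dimension \<open>m\<close>. The second one says that nearly the largest such \<open>m\<close> is taken.
\<close>

lemma doubly_exponential_scale:
  fixes L :: real
  obtains m :: nat where "m = 0 \<or> 21 * 2 ^ m \<le> L" and "L \<le> 42 * 2 ^ m"
proof -
  obtain m0 :: nat where "L < 2 ^ m0"
    using real_arch_pow[of 2 L] by auto
  then have ex: "L \<le> 42 * 2 ^ m0"
    by (smt (verit) zero_less_power)
  define m where "m = (LEAST m. L \<le> 42 * 2 ^ m)"
  have "L \<le> 42 * 2 ^ m"
    unfolding m_def using ex by (rule LeastI)
  moreover have "m = 0 \<or> 21 * 2 ^ m \<le> L"
  proof (cases m)
    case (Suc l)
    then have "\<not> L \<le> 42 * 2 ^ l"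
      using not_less_Least[of l "\<lambda>m. L \<le> 42 * 2 ^ m"] by (simp add: m_def)
    with Suc show ?thesis
      by simp
  qed simp
  ultimately show thesis
    using that by blast
qed

text \<open>
  If the base of the gain is at most \<open>1\<close>, then \<open>gamma_exponent p = 0\<close> and a single exponential,
  that is \<open>m = 0\<close>, suffices. Otherwise \<open>m\<close> is chosen as large as the cube lemma permits, and \<open>2 ^ m\<close>
  is then at least \<open>log 2 n / (42 * d)\<close>.
\<close>

lemma cube_dimension:
  fixes N n d :: nat and p :: real
  assumes N: "n \<le> N ^ d" and n: "2 \<le> n" and d: "0 < d"
  obtains m :: nat where "m = 0 \<or> (2 ^ 2 ^ m) ^ 21 \<le> N"
    and "(1 / (42 * real d)) powr gamma_exponent p * log 2 n powr gamma_exponent p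
           \<le> (pi / 2 powr (1 + 1 / p)) ^ m"
proof (cases "pi / 2 powr (1 + 1 / p) \<le> 1")
  case True
  then have "gamma_exponent p = 0"
    by (simp add: gamma_exponent_def)
  then show thesis
    using n d by (intro that[of 0]) auto
next
  case False
  define \<rho> where "\<rho> = pi / 2 powr (1 + 1 / p)"
  have \<rho>: "1 < \<rho>" and \<gamma>: "gamma_exponent p = log 2 \<rho>" "0 \<le> log 2 \<rho>"
    using False by (auto simp: \<rho>_def gamma_exponent_def)
  have N_pos: "0 < N"
    using N n d by (cases "N = 0") (auto simp: power_0_left)
  obtain m where m: "m = 0 \<or> 21 * 2 ^ m \<le> log 2 N" "log 2 N \<le> 42 * 2 ^ m"
    using doubly_exponential_scale[of "log 2 N"] .
  have scale: "(2 ^ 2 ^ m) ^ 21 \<le> N" if "m \<noteq> 0"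
  proof -
    have "2 powr (21 * 2 ^ m) \<le> 2 powr log 2 N"
      using m that by (intro powr_mono) auto
    also have "2 powr (21 * 2 ^ m) = 2 powr real (2 ^ m * 21)"
      by (simp add: mult.commute)
    also have "\<dots> = real ((2 ^ 2 ^ m) ^ 21)"
      by (subst powr_realpow) (simp_all add: power_mult)
    finally show ?thesis
      using N_pos by (simp del: of_nat_power)
  qed
  have "log 2 n / (42 * d) \<le> 2 ^ m"
  proof -
    have "log 2 n \<le> log 2 (real (N ^ d))"
      using N n N_pos by (subst log_le_cancel_iff) auto
    also have "\<dots> = d * log 2 N"
      using N_pos by (simp add: log_nat_power)
    also have "\<dots> \<le> real d * (42 * 2 ^ m)"
      using m by (intro mult_left_mono) auto
    finally show ?thesis
      using d by (simp add: field_simps)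
  qed
  then have "(log 2 n / (42 * d)) powr log 2 \<rho> \<le> (2 ^ m) powr log 2 \<rho>"
    using n \<gamma> by (intro powr_mono2) auto
  also have "(2 ^ m) powr log 2 \<rho> = (2 powr log 2 \<rho>) powr m"
    by (simp add: powr_powr mult.commute flip: powr_realpow)
  also have "\<dots> = \<rho> ^ m"
    using \<rho> by (simp add: powr_realpow)
  finally have "(1 / (42 * real d)) powr log 2 \<rho> * log 2 n powr log 2 \<rho> \<le> \<rho> ^ m"
    using n by (simp add: powr_divide)
  with scale show thesis
    using that[of m] by (auto simp: \<gamma> \<rho>_def)
qed

lemma box_side:
  fixes n d :: nat
  assumes n: "2 \<le> n" and d: "0 < d"
  obtains N :: nat where "0 < N" and "2 * n \<le> N ^ d" and "N \<le> 4 * real n powr (1 / d)"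
proof -
  define y where "y = (2 * real n) powr (1 / d)"
  have y: "1 \<le> y"
    using n by (simp add: y_def ge_one_powr_ge_zero)
  define N where "N = nat \<lceil>y\<rceil>"
  have N: "y \<le> N" "N \<le> y + 1"
    using y unfolding N_def by linarith+
  have "real (2 * n) = y ^ d"
    using n d by (simp add: y_def powr_powr flip: powr_realpow)
  also have "\<dots> \<le> real N ^ d"
    using N y by (intro power_mono) auto
  finally have "real (2 * n) \<le> real (N ^ d)"
    by simp
  then have "2 * n \<le> N ^ d"
    by (simp only: of_nat_le_iff)
  moreover have "N \<le> 4 * real n powr (1 / d)"
  proof -
    have "y = 2 powr (1 / d) * real n powr (1 / d)"
      by (simp add: y_def powr_mult)
    also have "\<dots> \<le> 2 powr 1 * real n powr (1 / d)"
      using d by (intro mult_right_mono powr_mono) auto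
    finally have "y \<le> 2 * real n powr (1 / d)"
      by simp
    moreover have "1 \<le> real n powr (1 / d)"
      using n by (simp add: ge_one_powr_ge_zero)
    ultimately show ?thesis
      using N by linarith
  qed
  moreover have "0 < N"
    using N y by linarith
  ultimately show thesis
    using that by blast
qed

theorem theorem2:
  fixes s p :: real and k :: nat
  assumes "s > 0" and "real k > s"
    and "1 \<le> p" and "p \<le> 2"
    and "s / real CARD('d::finite) \<ge> 1 - 1 / p"
  shows "\<exists>c::real. c > 0 \<and> (\<forall>n::nat. n \<ge> 2 \<longrightarrow>
           fourier_sampling_number (besov_ball k s :: (real ^ 'd \<Rightarrow> complex) set) p n
             \<ge> ennreal (c * real n powr (- s / real CARD('d)) * log 2 (real n) powr gamma_exponent p))"
proof -
  define d where "d = CARD('d)"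
  have d: "0 < d"
    by (simp add: d_def)
  define \<gamma> where "\<gamma> = gamma_exponent p"
  define c\<^sub>1 where "c\<^sub>1 = (1 / (42 * real d)) powr \<gamma>"
  define C where "C = 1 + 2 ^ k * (4 * (real d + 1)) powr s"
  have pos: "0 < c\<^sub>1" "0 < C"
    using d by (simp_all add: c\<^sub>1_def C_def add_pos_nonneg)
  have "ennreal (c\<^sub>1 / (3 * C) * real n powr (- s / d) * log 2 n powr \<gamma>)
      \<le> fourier_sampling_number (besov_ball k s :: (real ^ 'd \<Rightarrow> complex) set) p n" if n: "2 \<le> n" for n
    unfolding fourier_sampling_number_def
  proof (rule INF_greatest)
    fix \<xi> :: "nat \<Rightarrow> int ^ 'd"
    obtain N where N: "0 < N" "2 * n \<le> N ^ d" "N \<le> 4 * real n powr (1 / d)"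
      using box_side[OF n d] .
    have "n \<le> N ^ d"
      using N by simp
    from cube_dimension[OF this n d, of p, folded \<gamma>_def, folded c\<^sub>1_def]
    obtain m where m: "m = 0 \<or> (2 ^ 2 ^ m) ^ 21 \<le> N"
      and gain: "c\<^sub>1 * log 2 n powr \<gamma> \<le> (pi / 2 powr (1 + 1 / p)) ^ m"
      .
    have "card (\<xi> ` {1..n}) \<le> n"
      using card_image_le[of "{1..n}" \<xi>] by simp
    then have card: "2 * card (\<xi> ` {1..n}) \<le> N ^ CARD('d)"
      using N(2) by (simp add: d_def)
    obtain f :: "real ^ 'd \<Rightarrow> complex" where f: "f \<in> besov_ball k s"
      "\<And>\<eta>. \<eta> \<in> \<xi> ` {1..n} \<Longrightarrow> fourier_coeff f \<eta> = 0"
      and norm_f: "ennreal ((pi / 2 powr (1 + 1 / p)) ^ m / (3 * (1 + 2 ^ k * ((CARD('d) + 1) * N) powr s)))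
           \<le> torus_Lp_norm p f"
      using fooling_function[OF assms(1-4) finite_imageI[OF finite_atLeastAtMost] card N(1) m] by blast
    define D where "D = 1 + 2 ^ k * (real ((CARD('d) + 1) * N)) powr s"
    have D: "0 < D" "D \<le> C * real n powr (s / d)"
    proof -
      show "0 < D"
        by (simp add: D_def add_pos_nonneg)
      have "(real ((CARD('d) + 1) * N)) powr s \<le> (4 * (real d + 1) * real n powr (1 / d)) powr s"
        using N(3) assms(1) mult_left_mono[OF N(3), of "real d + 1"]
        by (intro powr_mono2) (auto simp: d_def algebra_simps)
      also have "\<dots> = (4 * (real d + 1)) powr s * real n powr (s / d)"
        by (simp add: powr_mult powr_powr)
      finally have "2 ^ k * real ((CARD('d) + 1) * N) powr s
          \<le> 2 ^ k * ((4 * (real d + 1)) powr s * real n powr (s / d))"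
        by (intro mult_left_mono) auto
      moreover have "1 \<le> real n powr (s / d)"
        using n assms(1) by (simp add: ge_one_powr_ge_zero)
      moreover have "C * real n powr (s / d)
          = real n powr (s / d) + 2 ^ k * ((4 * (real d + 1)) powr s * real n powr (s / d))"
        by (simp only: C_def distrib_right mult_1 mult.assoc)
      ultimately show "D \<le> C * real n powr (s / d)"
        unfolding D_def by linarith
    qed
    have "c\<^sub>1 / (3 * C) * real n powr (- s / d) * log 2 n powr \<gamma>
        = c\<^sub>1 * log 2 n powr \<gamma> / (3 * (C * real n powr (s / d)))"
      by (simp add: powr_minus_divide)
    also have "\<dots> \<le> c\<^sub>1 * log 2 n powr \<gamma> / (3 * D)"
      using D pos n by (intro divide_left_mono mult_pos_pos) auto
    also have "\<dots> \<le> (pi / 2 powr (1 + 1 / p)) ^ m / (3 * D)"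
      using gain D by (intro divide_right_mono) auto
    finally have "ennreal (c\<^sub>1 / (3 * C) * real n powr (- s / d) * log 2 n powr \<gamma>) \<le> torus_Lp_norm p f"
      using norm_f unfolding D_def by (meson ennreal_leI order.trans)
    then show "ennreal (c\<^sub>1 / (3 * C) * real n powr (- s / d) * log 2 n powr \<gamma>)
        \<le> (SUP f \<in> {f \<in> besov_ball k s. \<forall>i\<in>{1..n}. fourier_coeff f (\<xi> i) = 0}. torus_Lp_norm p f)"
      using f by (intro SUP_upper2[of f]) auto
  qed
  then show ?thesis
    using pos unfolding d_def \<gamma>_def by (intro exI[of _ "c\<^sub>1 / (3 * C)"]) auto
qed

end
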